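(* Assume that: for every $y\in\mathcal{Y}$, $u\mapsto\ell(y,u)$ is convex on $\mathbb{R}^p$; there is $\rho_p\in(0,+\infty)$ such that for every $y\in\mathcal{Y}$, $u\mapsto\ell(y,u)$ is $\rho_p$-Lipschitz on $\mathbb{R}^p$ for the Euclidean norm; and there is $c_\ell\in\mathbb{R}$ such that $\ell(y,u)\ge c_\ell$ for all $(y,u)\in\mathbb{R}^p\times\mathbb{R}^p$. Then for any $\alpha\in\left[\frac1{n+1},1\right)$, $$\widehat C^{\widehat\Gamma_a,\mathrm{full}}_{\lambda;\alpha}(X_{n+1})\subseteq\widetilde C^{\widehat\Gamma_a,\mathrm{up}}_{\lambda;\alpha}(X_{n+1}),$$ and as a result $$\mathbb{P}\left[Y_{n+1}\in\widetilde C^{\widehat\Gamma_a,\mathrm{up}}_{\lambda;\alpha}(X_{n+1})\right]\ge\mathbb{P}\left[Y_{n+1}\in\widehat C^{\widehat\Gamma_a,\mathrm{full}}_{\lambda;\alpha}(X_{n+1})\right]\ge1-\alpha.$$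
   Context: $\mathcal{X}\subset\mathbb{R}^d$, $\mathcal{Y}\subset\mathbb{R}^p$; $(X_1,Y_1),\dots,(X_{n+1},Y_{n+1})$ are exchangeable random variables in $\mathcal{X}\times\mathcal{Y}$; $\lambda\in(0,+\infty)$, $a\in(0,1)$. $\mathcal{H}$ is a reproducing kernel Hilbert space of functions $\mathcal{X}\to\mathbb{R}^p$ with matrix-valued kernel $K$: for all $x\in\mathcal{X}$, $v\in\mathbb{R}^p$, $K(\cdot,x)v\in\mathcal{H}$ and $\langle K(\cdot,x)v,f\rangle_{\mathcal{H}}=\langle v,f(x)\rangle$ for all $f\in\mathcal{H}$. $\ell:\mathbb{R}^p\times\mathbb{R}^p\to\mathbb{R}$ is a loss function; $\hat f_{\lambda';D'}$ is the (unique) minimizer over $f\in\mathcal{H}$ of $\frac{1}{|D'|}\sum_{(x,y)\in D'}\ell(y,f(x))+\lambda'\|f\|_{\mathcal{H}}^2$. $D$ consists of $(X_1,Y_1),\dots,(X_n,Y_n)$; for $y\in\mathcal{Y}$, $D^y$ consists of these points and $(X_{n+1},y)$. $\lambda^+:=\frac{n+1}n\lambda$. $\|\cdot\|$ is the Euclidean norm, $\|\cdot\|_{\mathrm{op}}$ the matrix operator norm. Covariance estimators: for a data set $D'$ of cardinality $m$ and $b>0$, $\widehat\mu_{D'}$ is the average of the output vectors in $D'$ and $\widehat\Gamma_{b;D'}:=\frac1m\sum_{(x,u)\in D'}uu^T-\widehat\mu_{D'}\widehat\mu_{D'}^T+bI_p$. Put $\widehat\Gamma_{a^+}:=\widehat\Gamma_{\frac{a(n+1)}{n};D}$.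 Score: $S^{\widehat\Gamma_a}_{\lambda;D^y}(x,u):=\|\widehat\Gamma_{a;D^y}^{-1/2}(u-\hat f_{\lambda;D^y}(x))\|$. Let $$\widehat\tau_\lambda^{\widehat\Gamma_{a^+}}(x):=\|\widehat\Gamma_{a^+}^{-1/2}K(x,x)\widehat\Gamma_{a^+}^{-1/2}\|_{\mathrm{op}}^{1/2}\frac{\rho_p\|K(X_{n+1},X_{n+1})\|_{\mathrm{op}}^{1/2}}{2\lambda(n+1)},\qquad\widehat t_{\lambda;a}:=\|\widehat\Gamma_{a^+}^{-1/2}(\hat f_{\lambda^+;D}(X_{n+1})-\widehat\mu_D)\|,$$ $$\widetilde S^{\widehat\Gamma_a,\mathrm{lo}}_{\lambda;D^y}(x,u):=\frac{\left(\frac{n+1}{n}\right)^{1/2}\left[\|\widehat\Gamma_{a^+}^{-1/2}(u-\hat f_{\lambda^+;D}(x))\|-\widehat\tau_\lambda^{\widehat\Gamma_{a^+}}(x)\right]}{\left(1+\frac1{n+1}\left(\|\widehat\Gamma_{a^+}^{-1/2}(y-\hat f_{\lambda^+;D}(X_{n+1}))\|+\widehat t_{\lambda;a}\right)^2\right)^{1/2}},$$ $$\widetilde S^{\widehat\Gamma_a,\mathrm{up}}_{\lambda;D^y}(x,u):=\left(\tfrac{n+1}{n}\right)^{1/2}\left[\|\widehat\Gamma_{a^+}^{-1/2}(u-\hat f_{\lambda^+;D}(x))\|+\widehat\tau_\lambda^{\widehat\Gamma_{a^+}}(x)\right].$$ Regions: $$\widetilde C^{\widehat\Gamma_a,\mathrm{up}}_{\lambda;\alpha}(X_{n+1}):=\left\{y\in\mathcal{Y}:\tfrac{1+\sum_{i=1}^n\mathbf{1}\{\widetilde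 S^{\widehat\Gamma_a,\mathrm{up}}_{\lambda;D^y}(X_i,Y_i)\ge\widetilde S^{\widehat\Gamma_a,\mathrm{lo}}_{\lambda;D^y}(X_{n+1},y)\}}{n+1}>\alpha\right\},$$ $$\widehat C^{\widehat\Gamma_a,\mathrm{full}}_{\lambda;\alpha}(X_{n+1}):=\left\{y\in\mathcal{Y}:\tfrac{1+\sum_{i=1}^n\mathbf{1}\{S^{\widehat\Gamma_a}_{\lambda;D^y}(X_i,Y_i)\ge S^{\widehat\Gamma_a}_{\lambda;D^y}(X_{n+1},y)\}}{n+1}>\alpha\right\}.$$
   Formalization: The probability inequalities are stated under the added condition that the two coverage events are measurable events of the sample space (X×Y)^{n+1}; without measurability of the loss, P[·] can be undefined or the bound 1−α can fail. The inclusion carries no such condition. *)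

theory Defs
  imports "HOL-Probability.Probability" "HOL-Combinatorics.Permutations" "HOL-Library.Multiset"
begin

section \<open>Vector-valued reproducing kernel Hilbert spaces\<close>

text \<open>
  A function from \<open>\<X>\<close> to \<open>\<real>\<^sup>p\<close> is represented by the function on the whole type that agrees with it
  on \<open>\<X>\<close> and vanishes outside \<open>\<X>\<close>. This makes equality of elements of \<open>\<H>\<close> the equality of
  functions on \<open>\<X>\<close>, and the vector space operations are the pointwise ones. The values of \<open>K\<close>
  outside \<open>\<X> \<times> \<X>\<close> and the values of \<open>ip\<close> outside \<open>\<H> \<times> \<H>\<close> are irrelevant.
\<close>

definition kernel_section ::
  "(real^'d) set \<Rightarrow> (real^'d \<Rightarrow> real^'d \<Rightarrow> real^'p^'p) \<Rightarrow> real^'d \<Rightarrow> real^'p \<Rightarrow> (real^'d \<Rightarrow> real^'p)"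
  where "kernel_section \<X> K x v = (\<lambda>x'. if x' \<in> \<X> then K x' x *v v else 0)"

locale rkhs =
  fixes \<X> :: "(real^'d) set"
    and \<H> :: "(real^'d \<Rightarrow> real^'p) set"
    and ip :: "(real^'d \<Rightarrow> real^'p) \<Rightarrow> (real^'d \<Rightarrow> real^'p) \<Rightarrow> real"
    and K :: "real^'d \<Rightarrow> real^'d \<Rightarrow> real^'p^'p"
  assumes support: "\<And>f x. f \<in> \<H> \<Longrightarrow> x \<notin> \<X> \<Longrightarrow> f x = 0"
    and zero_closed: "(\<lambda>x. 0) \<in> \<H>"
    and add_closed: "\<And>f g. f \<in> \<H> \<Longrightarrow> g \<in> \<H> \<Longrightarrow> (\<lambda>x. f x + g x) \<in> \<H>"
    and scale_closed: "\<And>c f. f \<in> \<H> \<Longrightarrow> (\<lambda>x. c *\<^sub>R f x) \<in> \<H>"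
    and ip_commute: "\<And>f g. f \<in> \<H> \<Longrightarrow> g \<in> \<H> \<Longrightarrow> ip f g = ip g f"
    and ip_add: "\<And>f g h. f \<in> \<H> \<Longrightarrow> g \<in> \<H> \<Longrightarrow> h \<in> \<H> \<Longrightarrow>
                   ip (\<lambda>x. f x + g x) h = ip f h + ip g h"
    and ip_scale: "\<And>c f g. f \<in> \<H> \<Longrightarrow> g \<in> \<H> \<Longrightarrow> ip (\<lambda>x. c *\<^sub>R f x) g = c * ip f g"
    and ip_nonneg: "\<And>f. f \<in> \<H> \<Longrightarrow> ip f f \<ge> 0"
    and ip_definite: "\<And>f. f \<in> \<H> \<Longrightarrow> ip f f = 0 \<Longrightarrow> f = (\<lambda>x. 0)"
    and complete: "\<And>F :: nat \<Rightarrow> real^'d \<Rightarrow> real^'p. (\<And>k. F k \<in> \<H>) \<Longrightarrow>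
        (\<forall>e>0. \<exists>N. \<forall>j\<ge>N. \<forall>k\<ge>N. sqrt (ip (\<lambda>x. F j x - F k x) (\<lambda>x. F j x - F k x)) < e) \<Longrightarrow>
        \<exists>f\<in>\<H>. (\<lambda>k. sqrt (ip (\<lambda>x. F k x - f x) (\<lambda>x. F k x - f x))) \<longlonglongrightarrow> 0"
    and kernel_in: "\<And>x v. x \<in> \<X> \<Longrightarrow> kernel_section \<X> K x v \<in> \<H>"
    and reproducing: "\<And>x v f. x \<in> \<X> \<Longrightarrow> f \<in> \<H> \<Longrightarrow> ip (kernel_section \<X> K x v) f = v \<bullet> f x"


section \<open>Regularized empirical risk minimization\<close>

text \<open>Data sets are multisets of input-output pairs, so repeated observations are counted.\<close>

definition reg_risk ::
  "((real^'d \<Rightarrow> real^'p) \<Rightarrow> (real^'d \<Rightarrow> real^'p) \<Rightarrow> real) \<Rightarrow> (real^'p \<Rightarrow> real^'p \<Rightarrow> real) \<Rightarrow> real \<Rightarrow>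
   ((real^'d) \<times> (real^'p)) multiset \<Rightarrow> (real^'d \<Rightarrow> real^'p) \<Rightarrow> real"
  where "reg_risk ip loss lam D f =
    (1 / real (size D)) * (\<Sum>(x, y)\<in>#D. loss y (f x)) + lam * ip f f"

definition fit ::
  "(real^'d \<Rightarrow> real^'p) set \<Rightarrow> ((real^'d \<Rightarrow> real^'p) \<Rightarrow> (real^'d \<Rightarrow> real^'p) \<Rightarrow> real) \<Rightarrow>
   (real^'p \<Rightarrow> real^'p \<Rightarrow> real) \<Rightarrow> real \<Rightarrow> ((real^'d) \<times> (real^'p)) multiset \<Rightarrow> (real^'d \<Rightarrow> real^'p)"
  where "fit \<H> ip loss lam D = (THE f. is_arg_min (reg_risk ip loss lam D) (\<lambda>f. f \<in> \<H>) f)"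


section \<open>Covariance estimators\<close>

definition psd_matrix :: "real^'p^'p \<Rightarrow> bool"
  where "psd_matrix A \<longleftrightarrow> transpose A = A \<and> (\<forall>v. v \<bullet> (A *v v) \<ge> 0)"

definition matrix_sqrt :: "real^'p^'p \<Rightarrow> real^'p^'p"
  where "matrix_sqrt A = (THE B. psd_matrix B \<and> B ** B = A)"

definition inv_sqrt :: "real^'p^'p \<Rightarrow> real^'p^'p"
  where "inv_sqrt A = matrix_inv (matrix_sqrt A)"

definition op_norm :: "real^'p^'p \<Rightarrow> real"
  where "op_norm A = onorm ((*v) A)"

definition outer_prod :: "real^'p \<Rightarrow> real^'p^'p"
  where "outer_prod u = (\<chi> i j. u $ i * u $ j)"

definition mean_out :: "((real^'d) \<times> (real^'p)) multiset \<Rightarrow> real^'p"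
  where "mean_out D = (1 / real (size D)) *\<^sub>R (\<Sum>(x, u)\<in>#D. u)"

definition cov_est :: "real \<Rightarrow> ((real^'d) \<times> (real^'p)) multiset \<Rightarrow> real^'p^'p"
  where "cov_est b D = (1 / real (size D)) *\<^sub>R (\<Sum>(x, u)\<in>#D. outer_prod u)
                         - outer_prod (mean_out D) + b *\<^sub>R mat 1"


section \<open>Scores and prediction regions\<close>

text \<open>A sample is a sequence \<open>z\<close> whose entries of index 1 to n+1 are the pairs \<open>(X\<^sub>i, Y\<^sub>i)\<close>.\<close>

definition data :: "nat \<Rightarrow> (nat \<Rightarrow> (real^'d) \<times> (real^'p)) \<Rightarrow> ((real^'d) \<times> (real^'p)) multiset"
  where "data n z = image_mset z (mset_set {1..n})"

definition data_aug ::
  "nat \<Rightarrow> (nat \<Rightarrow> (real^'d) \<times> (real^'p)) \<Rightarrow> real^'p \<Rightarrow> ((real^'d) \<times> (real^'p)) multiset"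
  where "data_aug n z y = add_mset (fst (z (n + 1)), y) (data n z)"

definition lam_plus :: "nat \<Rightarrow> real \<Rightarrow> real"
  where "lam_plus n lam = (real n + 1) / real n * lam"

definition Gam_plus :: "nat \<Rightarrow> real \<Rightarrow> (nat \<Rightarrow> (real^'d) \<times> (real^'p)) \<Rightarrow> real^'p^'p"
  where "Gam_plus n a z = cov_est (a * (real n + 1) / real n) (data n z)"

definition score ::
  "(real^'d \<Rightarrow> real^'p) set \<Rightarrow> ((real^'d \<Rightarrow> real^'p) \<Rightarrow> (real^'d \<Rightarrow> real^'p) \<Rightarrow> real) \<Rightarrow>
   (real^'p \<Rightarrow> real^'p \<Rightarrow> real) \<Rightarrow> real \<Rightarrow> real \<Rightarrow> ((real^'d) \<times> (real^'p)) multiset \<Rightarrow>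
   (real^'d) \<times> (real^'p) \<Rightarrow> real"
  where "score \<H> ip loss lam a D = (\<lambda>(x, u). norm (inv_sqrt (cov_est a D) *v (u - fit \<H> ip loss lam D x)))"

definition tau ::
  "(real^'d \<Rightarrow> real^'d \<Rightarrow> real^'p^'p) \<Rightarrow> real \<Rightarrow> real \<Rightarrow> real \<Rightarrow> nat \<Rightarrow> (nat \<Rightarrow> (real^'d) \<times> (real^'p)) \<Rightarrow>
   real^'d \<Rightarrow> real"
  where "tau K \<rho> lam a n z x =
    (let G = inv_sqrt (Gam_plus n a z); x' = fst (z (n + 1)) in
      sqrt (op_norm (G ** K x x ** G)) *
      (\<rho> * sqrt (op_norm (K x' x')) / (2 * lam * (real n + 1))))"

definition base_score ::
  "(real^'d \<Rightarrow> real^'p) set \<Rightarrow> ((real^'d \<Rightarrow> real^'p) \<Rightarrow> (real^'d \<Rightarrow> real^'p) \<Rightarrow> real) \<Rightarrow>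
   (real^'p \<Rightarrow> real^'p \<Rightarrow> real) \<Rightarrow> real \<Rightarrow> real \<Rightarrow> nat \<Rightarrow> (nat \<Rightarrow> (real^'d) \<times> (real^'p)) \<Rightarrow>
   (real^'d) \<times> (real^'p) \<Rightarrow> real"
  where "base_score \<H> ip loss lam a n z = (\<lambda>(x, u).
    norm (inv_sqrt (Gam_plus n a z) *v (u - fit \<H> ip loss (lam_plus n lam) (data n z) x)))"

definition t_hat ::
  "(real^'d \<Rightarrow> real^'p) set \<Rightarrow> ((real^'d \<Rightarrow> real^'p) \<Rightarrow> (real^'d \<Rightarrow> real^'p) \<Rightarrow> real) \<Rightarrow>
   (real^'p \<Rightarrow> real^'p \<Rightarrow> real) \<Rightarrow> real \<Rightarrow> real \<Rightarrow> nat \<Rightarrow> (nat \<Rightarrow> (real^'d) \<times> (real^'p)) \<Rightarrow> real"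
  where "t_hat \<H> ip loss lam a n z =
    norm (inv_sqrt (Gam_plus n a z) *v
            (fit \<H> ip loss (lam_plus n lam) (data n z) (fst (z (n + 1))) - mean_out (data n z)))"

definition score_lo ::
  "(real^'d \<Rightarrow> real^'p) set \<Rightarrow> ((real^'d \<Rightarrow> real^'p) \<Rightarrow> (real^'d \<Rightarrow> real^'p) \<Rightarrow> real) \<Rightarrow>
   (real^'d \<Rightarrow> real^'d \<Rightarrow> real^'p^'p) \<Rightarrow> (real^'p \<Rightarrow> real^'p \<Rightarrow> real) \<Rightarrow> real \<Rightarrow> real \<Rightarrow> real \<Rightarrow>
   nat \<Rightarrow> (nat \<Rightarrow> (real^'d) \<times> (real^'p)) \<Rightarrow> real^'p \<Rightarrow> (real^'d) \<times> (real^'p) \<Rightarrow> real"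
  where "score_lo \<H> ip K loss \<rho> lam a n z y = (\<lambda>(x, u).
    sqrt ((real n + 1) / real n) * (base_score \<H> ip loss lam a n z (x, u) - tau K \<rho> lam a n z x) /
    sqrt (1 + 1 / (real n + 1) *
            (base_score \<H> ip loss lam a n z (fst (z (n + 1)), y) + t_hat \<H> ip loss lam a n z)\<^sup>2))"

definition score_up ::
  "(real^'d \<Rightarrow> real^'p) set \<Rightarrow> ((real^'d \<Rightarrow> real^'p) \<Rightarrow> (real^'d \<Rightarrow> real^'p) \<Rightarrow> real) \<Rightarrow>
   (real^'d \<Rightarrow> real^'d \<Rightarrow> real^'p^'p) \<Rightarrow> (real^'p \<Rightarrow> real^'p \<Rightarrow> real) \<Rightarrow> real \<Rightarrow> real \<Rightarrow> real \<Rightarrow>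
   nat \<Rightarrow> (nat \<Rightarrow> (real^'d) \<times> (real^'p)) \<Rightarrow> (real^'d) \<times> (real^'p) \<Rightarrow> real"
  where "score_up \<H> ip K loss \<rho> lam a n z = (\<lambda>(x, u).
    sqrt ((real n + 1) / real n) * (base_score \<H> ip loss lam a n z (x, u) + tau K \<rho> lam a n z x))"

definition full_region ::
  "(real^'p) set \<Rightarrow> (real^'d \<Rightarrow> real^'p) set \<Rightarrow>
   ((real^'d \<Rightarrow> real^'p) \<Rightarrow> (real^'d \<Rightarrow> real^'p) \<Rightarrow> real) \<Rightarrow>
   (real^'p \<Rightarrow> real^'p \<Rightarrow> real) \<Rightarrow> real \<Rightarrow> real \<Rightarrow> real \<Rightarrow> nat \<Rightarrow> (nat \<Rightarrow> (real^'d) \<times> (real^'p)) \<Rightarrow> (real^'p) set"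
  where "full_region \<Y> \<H> ip loss lam a \<alpha> n z =
    {y \<in> \<Y>. (1 + (\<Sum>i=1..n. of_bool (score \<H> ip loss lam a (data_aug n z y) (z i)
                                \<ge> score \<H> ip loss lam a (data_aug n z y) (fst (z (n + 1)), y))))
             / (real n + 1) > \<alpha>}"

definition up_region ::
  "(real^'p) set \<Rightarrow> (real^'d \<Rightarrow> real^'p) set \<Rightarrow>
   ((real^'d \<Rightarrow> real^'p) \<Rightarrow> (real^'d \<Rightarrow> real^'p) \<Rightarrow> real) \<Rightarrow> (real^'d \<Rightarrow> real^'d \<Rightarrow> real^'p^'p) \<Rightarrow>
   (real^'p \<Rightarrow> real^'p \<Rightarrow> real) \<Rightarrow> real \<Rightarrow> real \<Rightarrow> real \<Rightarrow> real \<Rightarrow> nat \<Rightarrow> (nat \<Rightarrow> (real^'d) \<times> (real^'p)) \<Rightarrow>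
   (real^'p) set"
  where "up_region \<Y> \<H> ip K loss \<rho> lam a \<alpha> n z =
    {y \<in> \<Y>. (1 + (\<Sum>i=1..n. of_bool (score_up \<H> ip K loss \<rho> lam a n z (z i)
                                \<ge> score_lo \<H> ip K loss \<rho> lam a n z y (fst (z (n + 1)), y))))
             / (real n + 1) > \<alpha>}"


section \<open>Exchangeability\<close>

definition exchangeable :: "'w measure \<Rightarrow> 'b measure \<Rightarrow> nat set \<Rightarrow> (nat \<Rightarrow> 'w \<Rightarrow> 'b) \<Rightarrow> bool"
  where "exchangeable M N I Z \<longleftrightarrow>
    (\<forall>i\<in>I. Z i \<in> measurable M N) \<and>
    (\<forall>\<pi>. \<pi> permutes I \<longrightarrow>
       distr M (Pi\<^sub>M I (\<lambda>_. N)) (\<lambda>\<omega>. \<lambda>i\<in>I. Z (\<pi> i) \<omega>) = distr M (Pi\<^sub>M I (\<lambda>_. N)) (\<lambda>\<omega>. \<lambda>i\<in>I. Z i \<omega>))"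

end

theory Submission
  imports Defs
begin

text \<open>
  Replacing \<open>(\<lambda>, D\<^sup>y)\<close> by \<open>(\<lambda>\<^sup>+, D)\<close> removes a single loss term from the regularized risk. Since both
  objectives are strongly convex and the loss is Lipschitz, the two minimizers differ by at most
  \<open>\<rho> \<parallel>K(X\<^bsub>n+1\<^esub>, X\<^bsub>n+1\<^esub>)\<parallel>\<^sup>1\<^sup>/\<^sup>2 / (2\<lambda>(n+1))\<close> in the norm of \<open>\<H>\<close>, and the reproducing property turns this
  into the bound \<open>\<tau>\<close> on the whitened difference of their values. On the covariance side,
  \<open>\<Gamma>\<^sub>a(D\<^sup>y) = n/(n+1) (\<Gamma>\<^sup>+ + w w\<^sup>T/(n+1))\<close> with \<open>w = y - \<mu>(D)\<close>, and \<open>w w\<^sup>T \<le> \<parallel>(\<Gamma>\<^sup>+)\<^sup>-\<^sup>1\<^sup>/\<^sup>2 w\<parallel>\<^sup>2 \<Gamma>\<^sup>+\<close>, so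
  the two whitened norms are comparable with the factors of \<open>score_lo\<close> and \<open>score_up\<close>. Coverage of the
  full region holds because, for every threshold \<open>t\<close>, at most \<open>t\<close> indices \<open>j\<close> can have at most \<open>t\<close>
  scores greater than or equal to the \<open>j\<close>-th one, and by exchangeability every index is equally likely
  to be one of them.
\<close>

section \<open>Square roots of positive semidefinite matrices\<close>

lemma symmetric_matrix_inner:
  fixes A :: "real^'n^'n"
  assumes "transpose A = A"
  shows "x \<bullet> (A *v y) = (A *v x) \<bullet> y"
  by (metis assms dot_lmul_matrix transpose_matrix_vector)

lemma symmetric_matrixI:
  fixes A :: "real^'n^'n"
  assumes "\<And>x y. x \<bullet> (A *v y) = (A *v x) \<bullet> y"
  shows "transpose A = A"
proof -
  have "transpose A *v x = A *v x" for x
  proof (rule vector_eq_rdot[THEN iffD1], rule allI)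
    fix z show "(transpose A *v x) \<bullet> z = (A *v x) \<bullet> z"
      using assms[of x z] dot_lmul_matrix[of x A z] by simp
  qed
  then show ?thesis by (simp add: matrix_eq)
qed

text \<open>A first-order optimality condition without derivatives: the linear term dominates near
  zero and would change sign there. It is applied to variations around an extremum of a quadratic
  form.\<close>

lemma affine_quadratic_nonneg_imp_zero:
  fixes b c :: real
  assumes "\<And>t. 2 * t * b + t\<^sup>2 * c \<ge> 0"
  shows "b = 0"
proof (rule ccontr)
  assume b: "b \<noteq> 0"
  \<comment> \<open>At \<open>t = - s * b\<close> the expression equals
    \<open>s * b^2 * (s * c - 2)\<close>, and this choice keeps \<open>s * c\<close> at most
    1.\<close>
  define s where "s = 1 / (\<bar>c\<bar> + 1)"
  have s: "s > 0" "s * (\<bar>c\<bar> + 1) = 1" by (auto simp: s_def)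
  have "0 \<le> 2 * (- s * b) * b + (- s * b)\<^sup>2 * c" by (rule assms)
  also have "\<dots> = s * b\<^sup>2 * (s * c - 2)" by (simp add: power2_eq_square algebra_simps)
  finally have "0 \<le> s * b\<^sup>2 * (s * c - 2)" .
  moreover have "s * b\<^sup>2 > 0" using s b by simp
  ultimately have "s * c - 2 \<ge> 0" by (simp only: zero_le_mult_iff) linarith
  moreover have "s * c \<le> s * (\<bar>c\<bar> + 1)" using s by (intro mult_left_mono) auto
  ultimately show False using s by linarith
qed

text \<open>The point \<open>x\<close> minimizes the form of \<open>B\<close>, so the first
  variation in the direction \<open>B *v x\<close> vanishes; that variation is twice the squared
  norm of \<open>B *v x\<close>.\<close>

lemma psd_matrix_kernel:
  assumes B: "psd_matrix B" and z: "x \<bullet> (B *v x) = 0"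
  shows "B *v x = 0"
proof -
  have sym: "transpose B = B" and nn: "\<And>v. v \<bullet> (B *v v) \<ge> 0"
    using B by (auto simp: psd_matrix_def)
  let ?w = "B *v x"
  have "2 * t * (?w \<bullet> ?w) + t\<^sup>2 * (?w \<bullet> (B *v ?w)) \<ge> 0" for t
  proof -
    have "x \<bullet> (B *v ?w) = ?w \<bullet> ?w"
      using sym by (rule symmetric_matrix_inner)
    then have "(x + t *\<^sub>R ?w) \<bullet> (B *v (x + t *\<^sub>R ?w))
        = 2 * t * (?w \<bullet> ?w) + t\<^sup>2 * (?w \<bullet> (B *v ?w))"
      using z by (simp add: matrix_vector_right_distrib matrix_vector_mult_scaleR inner_add_left
          inner_add_right power2_eq_square algebra_simps)
    then show ?thesis using nn[of "x + t *\<^sub>R ?w"] by simp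
  qed
  then have "?w \<bullet> ?w = 0" by (rule affine_quadratic_nonneg_imp_zero)
  then show ?thesis by simp
qed

text \<open>Maximize the quadratic form over the compact unit sphere of \<open>S\<close>. Optimality
  makes \<open>l *\<^sub>R e - A *v e\<close> orthogonal to \<open>S\<close>, while invariance
  places it in \<open>S\<close>, so it is orthogonal to itself.\<close>

lemma symmetric_eigenvector_in_subspace:
  fixes A :: "real^'n^'n"
  assumes sym: "transpose A = A" and S: "subspace S" and ne: "S \<noteq> {0}"
    and inv: "\<And>v. v \<in> S \<Longrightarrow> A *v v \<in> S"
  obtains e l where "e \<in> S" "norm e = 1" "A *v e = l *\<^sub>R e"
proof -
  let ?C = "S \<inter> sphere 0 1"
  have "compact ?C"
    using closed_subspace[OF S] by (simp add: closed_Int_compact)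
  moreover have "?C \<noteq> {}"
  proof -
    obtain v where v: "v \<in> S" "v \<noteq> 0" using ne subspace_0[OF S] by blast
    then have "v /\<^sub>R norm v \<in> ?C" using S by (simp add: subspace_scale)
    then show ?thesis by blast
  qed
  moreover have "continuous_on ?C (\<lambda>v. v \<bullet> (A *v v))"
    by (intro continuous_intros matrix_vector_mult_linear_continuous_on)
  ultimately obtain e where e: "e \<in> ?C" and mx: "\<forall>v\<in>?C. v \<bullet> (A *v v) \<le> e \<bullet> (A *v e)"
    using continuous_attains_sup by blast
  define l where "l = e \<bullet> (A *v e)"
  have eS: "e \<in> S" and e1: "e \<bullet> e = 1" using e by (auto simp: dot_square_norm)
  have q: "v \<bullet> (A *v v) \<le> l * (v \<bullet> v)" if v: "v \<in> S" for v
  proof (cases "v = 0")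
    case False
    then have "v /\<^sub>R norm v \<in> ?C" using S v by (simp add: subspace_scale)
    then have "(v /\<^sub>R norm v) \<bullet> (A *v (v /\<^sub>R norm v)) \<le> l" using mx l_def by blast
    then have "v \<bullet> (A *v v) / (norm v)\<^sup>2 \<le> l"
      by (simp add: matrix_vector_mult_scaleR power2_eq_square divide_simps)
    then show ?thesis using False by (simp add: divide_le_eq dot_square_norm)
  qed auto
  \<comment> \<open>The defect \<open>l * (v \<bullet> v) - v \<bullet> (A *v v)\<close> is
    nonnegative on \<open>S\<close> and zero at \<open>e\<close>, so its expansion at
    \<open>e + t *\<^sub>R w\<close> has no constant term.\<close>
  have orth: "l * (e \<bullet> w) - w \<bullet> (A *v e) = 0" if w: "w \<in> S" for w
  proof (rule affine_quadratic_nonneg_imp_zero[where c = "l * (w \<bullet> w) - w \<bullet> (A *v w)"])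
    fix t
    have "e + t *\<^sub>R w \<in> S" using S eS w by (simp add: subspace_add subspace_scale)
    moreover have "e \<bullet> (A *v w) = w \<bullet> (A *v e)"
      using symmetric_matrix_inner[OF sym, of e w] by (simp add: inner_commute)
    ultimately show "0 \<le> 2 * t * (l * (e \<bullet> w) - w \<bullet> (A *v e)) + t\<^sup>2 * (l * (w \<bullet> w) - w \<bullet> (A *v w))"
      using q[of "e + t *\<^sub>R w"] e1 l_def
      by (simp add: matrix_vector_right_distrib matrix_vector_mult_scaleR inner_add_left
          inner_add_right power2_eq_square inner_commute algebra_simps)
  qed
  have "l *\<^sub>R e - A *v e \<in> S" using S eS inv by (simp add: subspace_diff subspace_scale)
  from orth[OF this] have "(l *\<^sub>R e - A *v e) \<bullet> (l *\<^sub>R e - A *v e) = 0"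
    by (simp add: inner_diff_left inner_diff_right inner_commute algebra_simps)
  then have "A *v e = l *\<^sub>R e" by simp
  then show thesis using that[of e l] e by auto
qed

lemma outer_prod_mult_vec: "outer_prod u *v v = (u \<bullet> v) *\<^sub>R u"
  by (simp add: outer_prod_def matrix_vector_mult_def vec_eq_iff inner_vec_def sum_distrib_left
      sum_distrib_right mult_ac)

text \<open>The spectral theorem, by induction on the dimension: split off a unit eigenvector
  \<open>e\<close>, take the root on its orthogonal complement in \<open>S\<close>, and add
  \<open>sqrt l\<close> times the projection onto \<open>e\<close>. Vanishing on vectors orthogonal
  to \<open>S\<close> belongs to the induction because it gives \<open>B *v e = 0\<close>, so that
  the two summands do not interact.\<close>

lemma psd_matrix_sqrt_on_subspace:
  fixes A :: "real^'n^'n"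
  assumes A: "psd_matrix A" and S: "subspace S" and inv: "\<And>v. v \<in> S \<Longrightarrow> A *v v \<in> S"
  shows "\<exists>B. psd_matrix B \<and> (\<forall>v\<in>S. B *v v \<in> S \<and> B *v (B *v v) = A *v v)
           \<and> (\<forall>v. (\<forall>w\<in>S. v \<bullet> w = 0) \<longrightarrow> B *v v = 0)"
  using S inv
proof (induction "dim S" arbitrary: S rule: less_induct)
  case less
  show ?case
  proof (cases "S = {0}")
    case True
    then show ?thesis
      by (intro exI[of _ 0]) (simp add: psd_matrix_def transpose_def vec_eq_iff)
  next
    case False
    have symA: "transpose A = A" and nnA: "\<And>v. v \<bullet> (A *v v) \<ge> 0"
      using A by (auto simp: psd_matrix_def)
    obtain e l where e: "e \<in> S" "norm e = 1" "A *v e = l *\<^sub>R e"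
      using symmetric_eigenvector_in_subspace[OF symA less.prems(1) False less.prems(2)] by blast
    have ee: "e \<bullet> e = 1" using e(2) by (simp add: dot_square_norm)
    have l: "l \<ge> 0" using nnA[of e] e ee by simp
    define T where "T = {v \<in> S. e \<bullet> v = 0}"
    have T: "subspace T"
      using less.prems(1) unfolding T_def subspace_def by (auto simp: inner_add_right)
    have invT: "A *v v \<in> T" if "v \<in> T" for v
      using that less.prems(2) symmetric_matrix_inner[OF symA, of e v] e by (auto simp: T_def)
    have "e \<notin> T" using ee by (simp add: T_def)
    moreover have "T \<subseteq> S" by (auto simp: T_def)
    ultimately have "T \<subset> S" using e(1) by blast
    then have "dim T < dim S"
      using dim_psubset[of T S] T less.prems(1) by (metis span_eq_iff)
    from less.hyps[OF this T invT] obtain B where B: "psd_matrix B"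
      "\<And>v. v \<in> T \<Longrightarrow> B *v v \<in> T" "\<And>v. v \<in> T \<Longrightarrow> B *v (B *v v) = A *v v"
      "\<And>v. \<forall>w\<in>T. v \<bullet> w = 0 \<Longrightarrow> B *v v = 0" by blast
    define C where "C = B + sqrt l *\<^sub>R outer_prod e"
    have C: "C *v v = B *v v + (sqrt l * (e \<bullet> v)) *\<^sub>R e" for v
      by (simp add: C_def matrix_vector_mult_add_rdistrib scaleR_matrix_vector_assoc[symmetric] outer_prod_mult_vec)
    have symB: "x \<bullet> (B *v y) = (B *v x) \<bullet> y" for x y
      using B(1) symmetric_matrix_inner unfolding psd_matrix_def by blast
    have "psd_matrix C"
      unfolding psd_matrix_def
    proof (intro conjI allI symmetric_matrixI)
      fix x y show "x \<bullet> (C *v y) = (C *v x) \<bullet> y"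
        using symB[of x y] by (simp add: C inner_add_left inner_add_right inner_commute)
    next
      fix v
      have "v \<bullet> (C *v v) = v \<bullet> (B *v v) + sqrt l * (e \<bullet> v)\<^sup>2"
        by (simp add: C inner_add_right inner_commute power2_eq_square)
      then show "v \<bullet> (C *v v) \<ge> 0" using B(1) l by (auto simp: psd_matrix_def)
    qed
    moreover have "C *v v \<in> S \<and> C *v (C *v v) = A *v v" if v: "v \<in> S" for v
    proof -
      define u where "u = v - (e \<bullet> v) *\<^sub>R e"
      have u: "u \<in> T" using v e ee less.prems(1)
        by (simp add: u_def T_def inner_diff_right subspace_diff subspace_scale)
      have vu: "v = u + (e \<bullet> v) *\<^sub>R e" by (simp add: u_def)
      have Be: "B *v e = 0" by (rule B(4)) (simp add: T_def)
      have Cv: "C *v v = B *v u + (sqrt l * (e \<bullet> v)) *\<^sub>R e"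
        by (simp add: C u_def matrix_vector_mult_diff_distrib matrix_vector_mult_scaleR Be)
      have "B *v u \<in> T" using B(2) u by blast
      then have eBu: "e \<bullet> (B *v u) = 0" and BuS: "B *v u \<in> S" by (auto simp: T_def)
      have "C *v v \<in> S" unfolding Cv using BuS e less.prems(1) by (simp add: subspace_add subspace_scale)
      moreover have "C *v (C *v v) = B *v (B *v u) + (sqrt l * sqrt l * (e \<bullet> v)) *\<^sub>R e"
        unfolding Cv using eBu ee Be
        by (simp add: C matrix_vector_right_distrib matrix_vector_mult_scaleR inner_add_right mult_ac)
      then have "C *v (C *v v) = A *v u + (e \<bullet> v) *\<^sub>R (A *v e)"
        using B(3)[OF u] l e(3) by (simp add: mult_ac)
      then have "C *v (C *v v) = A *v v"
        by (subst vu) (simp add: matrix_vector_right_distrib matrix_vector_mult_scaleR)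
      ultimately show ?thesis by blast
    qed
    moreover have "C *v v = 0" if v: "\<forall>w\<in>S. v \<bullet> w = 0" for v
    proof -
      have "B *v v = 0" by (rule B(4)) (use v in \<open>auto simp: T_def\<close>)
      then show ?thesis using v e by (simp add: C inner_commute)
    qed
    ultimately show ?thesis by blast
  qed
qed

lemma psd_matrix_sqrt_exists:
  fixes A :: "real^'n^'n"
  assumes "psd_matrix A"
  shows "\<exists>B. psd_matrix B \<and> B ** B = A"
proof -
  obtain B where "psd_matrix B" "\<forall>v. B *v (B *v v) = A *v v"
    using psd_matrix_sqrt_on_subspace[OF assms subspace_UNIV] by auto
  then show ?thesis by (auto simp: matrix_eq matrix_vector_mul_assoc)
qed

text \<open>With \<open>D = B - C\<close> one has \<open>B D + D C = B\<^sup>2 - C\<^sup>2 = 0\<close>, so the nonnegative numbers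
  \<open>D w \<bullet> B (D w)\<close> and \<open>D w \<bullet> C (D w)\<close> have sum zero once summed over an orthonormal basis.\<close>

lemma psd_matrix_sqrt_unique:
  fixes B C :: "real^'n^'n"
  assumes B: "psd_matrix B" and C: "psd_matrix C" and eq: "B ** B = C ** C"
  shows "B = C"
proof -
  have symB: "x \<bullet> (B *v y) = (B *v x) \<bullet> y" and symC: "x \<bullet> (C *v y) = (C *v x) \<bullet> y" for x y
    using B C symmetric_matrix_inner unfolding psd_matrix_def by blast+
  define D where "D = B - C"
  have Dv: "D *v x = B *v x - C *v x" for x
    by (simp add: D_def matrix_vector_mult_diff_rdistrib)
  have symD: "x \<bullet> (D *v y) = (D *v x) \<bullet> y" for x y
    using symB symC by (simp add: Dv inner_diff_left inner_diff_right)
  have DE: "B *v (D *v x) + D *v (C *v x) = 0" for x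
    unfolding Dv matrix_vector_mult_diff_distrib by (simp add: eq matrix_vector_mul_assoc)
  let ?b = "\<lambda>x. (D *v x) \<bullet> (B *v (D *v x))" and ?c = "\<lambda>x. (D *v x) \<bullet> (C *v (D *v x))"
  have nn: "?b x \<ge> 0" "?c x \<ge> 0" for x using B C by (auto simp: psd_matrix_def)
  \<comment> \<open>Cyclicity of the trace, tr(DDC) = tr(DCD), proved by expanding both inner
    products in the basis and swapping the sums.\<close>
  have tr: "(\<Sum>x\<in>Basis. (D *v x) \<bullet> (D *v (C *v x))) = (\<Sum>x\<in>Basis. ?c x)"
  proof -
    have "(\<Sum>x\<in>Basis. (D *v x) \<bullet> (D *v (C *v x)))
        = (\<Sum>x\<in>Basis. \<Sum>y\<in>Basis. ((D *v x) \<bullet> y) * ((D *v (C *v x)) \<bullet> y))"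
      by (intro sum.cong refl) (rule euclidean_inner)
    also have "\<dots> = (\<Sum>y\<in>Basis. \<Sum>x\<in>Basis. ((D *v x) \<bullet> y) * ((D *v (C *v x)) \<bullet> y))"
      by (rule sum.swap)
    also have "\<dots> = (\<Sum>y\<in>Basis. \<Sum>x\<in>Basis. ((D *v y) \<bullet> x) * ((C *v (D *v y)) \<bullet> x))"
      by (intro sum.cong refl) (metis symC symD inner_commute)
    also have "\<dots> = (\<Sum>y\<in>Basis. ?c y)"
      by (intro sum.cong refl) (rule euclidean_inner[symmetric])
    finally show ?thesis .
  qed
  have "(\<Sum>x\<in>Basis. ?b x + ?c x) = (\<Sum>x\<in>Basis. (D *v x) \<bullet> (B *v (D *v x) + D *v (C *v x)))"
    by (simp add: sum.distrib tr inner_add_right)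
  also have "\<dots> = 0" by (simp add: DE)
  finally have "\<forall>x\<in>Basis. ?b x + ?c x = 0"
    using nn by (subst (asm) sum_nonneg_eq_0_iff) (auto intro: add_nonneg_nonneg)
  then have z: "?b x = 0" "?c x = 0" if "x \<in> Basis" for x
    using nn[of x] that by (auto simp: add_nonneg_eq_0_iff)
  have "D *v x = 0" if x: "x \<in> Basis" for x
  proof -
    have "B *v (D *v x) = 0" "C *v (D *v x) = 0"
      using psd_matrix_kernel[OF B] psd_matrix_kernel[OF C] z[OF x] by auto
    then have "D *v (D *v x) = 0" by (simp add: Dv)
    then have "(D *v x) \<bullet> (D *v x) = 0" using symD[of x "D *v x"] by simp
    then show ?thesis by simp
  qed
  then have "D *v x = 0" for x
    using linear_eq_stdbasis[OF matrix_vector_mul_linear[of D] linear_zero] by metis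
  then show ?thesis by (simp add: Dv matrix_eq)
qed

lemma matrix_sqrt:
  fixes A :: "real^'n^'n"
  assumes "psd_matrix A"
  shows "psd_matrix (matrix_sqrt A)" "matrix_sqrt A ** matrix_sqrt A = A"
proof -
  have "\<exists>!B. psd_matrix B \<and> B ** B = A"
    using psd_matrix_sqrt_exists[OF assms] psd_matrix_sqrt_unique by metis
  from theI'[OF this] show "psd_matrix (matrix_sqrt A)" "matrix_sqrt A ** matrix_sqrt A = A"
    unfolding matrix_sqrt_def by auto
qed

section \<open>Positive definite matrices and whitened norms\<close>

definition pd_matrix :: "real^'n^'n \<Rightarrow> bool"
  where "pd_matrix A \<longleftrightarrow> transpose A = A \<and> (\<forall>v. v \<noteq> 0 \<longrightarrow> v \<bullet> (A *v v) > 0)"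

lemma pd_matrix_imp_psd: "pd_matrix A \<Longrightarrow> psd_matrix A"
  unfolding pd_matrix_def psd_matrix_def by (metis inner_zero_left less_eq_real_def)

text \<open>A vector killed by the root is killed by \<open>A\<close>, hence is zero. The root is
  therefore invertible and \<open>matrix_inv\<close> inside \<open>inv_sqrt\<close> is a genuine
  inverse.\<close>

lemma pd_matrix_sqrt_inverse:
  fixes A :: "real^'n^'n"
  assumes "pd_matrix A"
  shows "matrix_sqrt A ** inv_sqrt A = mat 1" "inv_sqrt A ** matrix_sqrt A = mat 1"
proof -
  let ?B = "matrix_sqrt A"
  have B: "psd_matrix ?B" "?B ** ?B = A" using matrix_sqrt[OF pd_matrix_imp_psd[OF assms]] by auto
  have "x = 0" if "?B *v x = 0" for x
  proof (rule ccontr)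
    assume "x \<noteq> 0"
    then have "x \<bullet> (A *v x) > 0" using assms by (auto simp: pd_matrix_def)
    moreover have "A *v x = 0"
      using that by (subst B(2)[symmetric]) (simp add: matrix_vector_mul_assoc[symmetric])
    ultimately show False by simp
  qed
  then obtain C where "C ** ?B = mat 1" using matrix_left_invertible_ker by blast
  then have "invertible ?B" unfolding invertible_def using matrix_left_right_inverse by blast
  then show "?B ** inv_sqrt A = mat 1" "inv_sqrt A ** ?B = mat 1"
    unfolding inv_sqrt_def matrix_inv_def using someI_ex[OF \<open>invertible ?B\<close>[unfolded invertible_def]]
    by blast+
qed

lemma inv_sqrt_symmetric:
  fixes A :: "real^'n^'n"
  assumes "pd_matrix A"
  shows "transpose (inv_sqrt A) = inv_sqrt A"
proof -
  let ?B = "matrix_sqrt A" and ?G = "inv_sqrt A"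
  have tB: "transpose ?B = ?B"
    using matrix_sqrt[OF pd_matrix_imp_psd[OF assms]] by (auto simp: psd_matrix_def)
  have "transpose ?G ** ?B = mat 1"
    using arg_cong[OF pd_matrix_sqrt_inverse(1)[OF assms], of transpose]
    by (simp add: matrix_transpose_mul tB)
  then have "transpose ?G ** (?B ** ?G) = ?G" by (simp add: matrix_mul_assoc)
  then show ?thesis by (simp add: pd_matrix_sqrt_inverse(1)[OF assms])
qed

lemma norm_matrix_sqrt_sq:
  assumes "pd_matrix A"
  shows "(norm (matrix_sqrt A *v v))\<^sup>2 = v \<bullet> (A *v v)"
proof -
  have B: "psd_matrix (matrix_sqrt A)" "matrix_sqrt A ** matrix_sqrt A = A"
    using matrix_sqrt[OF pd_matrix_imp_psd[OF assms]] by auto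
  have "v \<bullet> (A *v v) = (matrix_sqrt A *v v) \<bullet> (matrix_sqrt A *v v)"
    using B symmetric_matrix_inner[of "matrix_sqrt A" v "matrix_sqrt A *v v"]
    by (simp add: psd_matrix_def matrix_vector_mul_assoc)
  then show ?thesis by (simp add: dot_square_norm)
qed

text \<open>Cauchy-Schwarz after inserting the identity as inverse root times root: the whitened
  norm is dual to the norm defined by \<open>A\<close>.\<close>

lemma inner_le_inv_sqrt:
  assumes "pd_matrix A"
  shows "\<bar>v \<bullet> w\<bar> \<le> norm (inv_sqrt A *v v) * norm (matrix_sqrt A *v w)"
proof -
  have "v \<bullet> w = v \<bullet> ((inv_sqrt A ** matrix_sqrt A) *v w)"
    by (simp add: pd_matrix_sqrt_inverse[OF assms])
  also have "\<dots> = (inv_sqrt A *v v) \<bullet> (matrix_sqrt A *v w)"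
    using symmetric_matrix_inner[OF inv_sqrt_symmetric[OF assms]]
    by (simp add: matrix_vector_mul_assoc[symmetric])
  finally show ?thesis by (simp add: Cauchy_Schwarz_ineq2)
qed

text \<open>Inversion reverses the Loewner order. The vector \<open>w\<close>, which is the inverse
  of \<open>A\<close> applied to \<open>v\<close>, gives equality in the duality for
  \<open>A\<close>; the duality for \<open>B\<close> then bounds the squared left side by the right
  side times the left side, and one factor cancels.\<close>

lemma inv_sqrt_antimono:
  fixes A B :: "real^'n^'n"
  assumes A: "pd_matrix A" and B: "pd_matrix B" and k: "k \<ge> 0"
    and le: "\<And>v. v \<bullet> (B *v v) \<le> k * (v \<bullet> (A *v v))"
  shows "norm (inv_sqrt A *v v) \<le> sqrt k * norm (inv_sqrt B *v v)"
proof -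
  define w where "w = inv_sqrt A *v (inv_sqrt A *v v)"
  let ?a = "norm (inv_sqrt A *v v)"
  have Aw: "matrix_sqrt A *v w = inv_sqrt A *v v"
    by (simp add: w_def matrix_vector_mul_assoc matrix_mul_assoc pd_matrix_sqrt_inverse[OF A])
  have "(norm (matrix_sqrt B *v w))\<^sup>2 \<le> k * ?a\<^sup>2"
    using le[of w] by (simp add: norm_matrix_sqrt_sq[OF A, symmetric] norm_matrix_sqrt_sq[OF B, symmetric] Aw)
  then have Bw: "norm (matrix_sqrt B *v w) \<le> sqrt k * ?a"
    using real_le_rsqrt by (fastforce simp: real_sqrt_mult)
  have "?a\<^sup>2 = v \<bullet> w"
    unfolding w_def using symmetric_matrix_inner[OF inv_sqrt_symmetric[OF A], of v]
    by (simp add: dot_square_norm)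
  also have "\<dots> \<le> norm (inv_sqrt B *v v) * (sqrt k * ?a)"
    using inner_le_inv_sqrt[OF B, of v w] mult_left_mono[OF Bw, of "norm (inv_sqrt B *v v)"] by simp
  finally have "?a * ?a \<le> (sqrt k * norm (inv_sqrt B *v v)) * ?a" by (simp add: power2_eq_square mult_ac)
  then show ?thesis
    using k by (cases "?a = 0") (simp_all add: mult_le_cancel_right)
qed

section \<open>Adding a point to the covariance estimator\<close>

lemma sum_mset_outer_prod_quadratic:
  "v \<bullet> ((\<Sum>(x, u)\<in>#D. outer_prod u) *v v) = (\<Sum>(x, u)\<in>#D. (u \<bullet> v)\<^sup>2)"
  by (induction D) (auto simp: matrix_vector_mult_add_rdistrib inner_add_right outer_prod_mult_vec
      power2_eq_square inner_commute)

lemma sum_mset_inner_left: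
  "(\<Sum>(x, u)\<in>#D. u) \<bullet> v = (\<Sum>(x, u)\<in>#D. u \<bullet> v)"
  by (induction D) (auto simp: inner_add_left)

text \<open>Mean square minus squared mean is the mean of the squared deviations. The empty multiset
  is covered because division by zero yields zero.\<close>

lemma empirical_variance_nonneg:
  fixes f :: "'a \<Rightarrow> real"
  shows "(1 / real (size D) * (\<Sum>x\<in>#D. f x))\<^sup>2 \<le> 1 / real (size D) * (\<Sum>x\<in>#D. (f x)\<^sup>2)"
proof (cases "size D = 0")
  case False
  define m where "m = real (size D)"
  define t where "t = 1 / m * (\<Sum>x\<in>#D. f x)"
  have m: "m > 0" using False by (simp only: m_def)
  \<comment> \<open>Expansion around an arbitrary centre; at the mean the last two terms combine to
    \<open>- m * t^2\<close>.\<close>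
  have "(\<Sum>x\<in>#D. (f x - t)\<^sup>2) = (\<Sum>x\<in>#D. (f x)\<^sup>2) - 2 * t * (\<Sum>x\<in>#D. f x) + m * t\<^sup>2" for t
    unfolding m_def by (induction D) (auto simp: power2_eq_square algebra_simps)
  moreover have "(\<Sum>x\<in>#D. f x) = m * t" using m by (simp add: t_def)
  ultimately have "(\<Sum>x\<in>#D. (f x - t)\<^sup>2) = (\<Sum>x\<in>#D. (f x)\<^sup>2) - m * t\<^sup>2"
    by (simp add: power2_eq_square)
  moreover have "(\<Sum>x\<in>#D. (f x - t)\<^sup>2) \<ge> 0" by (induction D) auto
  ultimately have "t\<^sup>2 \<le> 1 / m * (\<Sum>x\<in>#D. (f x)\<^sup>2)" using m by (simp add: field_simps)
  then show ?thesis by (simp only: t_def m_def)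
qed simp

lemma transpose_add: "transpose (A + B) = transpose A + transpose (B :: 'a::ab_group_add^'n^'m)"
  by (simp add: transpose_def vec_eq_iff)

lemma transpose_diff: "transpose (A - B) = transpose A - transpose (B :: 'a::ab_group_add^'n^'m)"
  by (simp add: transpose_def vec_eq_iff)

lemma transpose_outer_prod [simp]: "transpose (outer_prod u) = outer_prod u"
  by (simp add: outer_prod_def transpose_def vec_eq_iff)

text \<open>In a fixed direction the estimator is the empirical variance of the projected outputs
  plus a ridge term, which reduces positive definiteness to a scalar inequality.\<close>

lemma cov_est_quadratic:
  "v \<bullet> (cov_est b D *v v) = 1 / real (size D) * (\<Sum>(x, u)\<in>#D. (u \<bullet> v)\<^sup>2)
     - (1 / real (size D) * (\<Sum>(x, u)\<in>#D. u \<bullet> v))\<^sup>2 + b * (v \<bullet> v)"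
proof -
  have "mean_out D \<bullet> v = 1 / real (size D) * (\<Sum>(x, u)\<in>#D. u \<bullet> v)"
    by (simp add: mean_out_def sum_mset_inner_left)
  then show ?thesis
    unfolding cov_est_def sum_mset_outer_prod_quadratic[symmetric]
    by (simp add: matrix_vector_mult_add_rdistrib matrix_vector_mult_diff_rdistrib inner_add_right
        inner_diff_right scaleR_matrix_vector_assoc[symmetric] outer_prod_mult_vec power2_eq_square
        inner_commute)
qed

lemma pd_matrix_cov_est:
  fixes D :: "((real^'d) \<times> (real^'p)) multiset"
  assumes "b > 0"
  shows "pd_matrix (cov_est b D)"
  unfolding pd_matrix_def
proof (intro conjI allI impI)
  have "transpose (\<Sum>(x, u)\<in>#D. outer_prod u) = (\<Sum>(x, u)\<in>#D. outer_prod u)"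
    by (induction D) (auto simp: transpose_add, simp add: transpose_def vec_eq_iff)
  then show "transpose (cov_est b D) = cov_est b D"
    by (simp add: cov_est_def transpose_add transpose_diff transpose_scalar)
next
  fix v :: "real^'p" assume "v \<noteq> 0"
  then have "b * (v \<bullet> v) > 0" using assms by simp
  then show "v \<bullet> (cov_est b D *v v) > 0"
    using empirical_variance_nonneg[of D "\<lambda>(x, u). u \<bullet> v"] unfolding cov_est_quadratic
    by (simp add: case_prod_unfold)
qed

text \<open>The rank-one update of an empirical covariance. The ridge
  \<open>a * (real n + 1) / real n\<close> on the right is the one that becomes exactly
  \<open>a\<close> after scaling by \<open>n/(n+1)\<close>.\<close>

lemma cov_est_add_mset:
  assumes "size D = n" and "n \<ge> 1"
  shows "cov_est a (add_mset (x, y) D) =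
    (real n / (real n + 1)) *\<^sub>R (cov_est (a * (real n + 1) / real n) D
       + (1 / (real n + 1)) *\<^sub>R outer_prod (y - mean_out D))"
proof -
  define N where "N = real n"
  have N: "N > 0" using assms by (simp add: N_def)
  define S where "S = (\<Sum>(x, u)\<in>#D. outer_prod u)"
  define m where "m = mean_out D"
  have sum: "(\<Sum>(x, u)\<in>#D. u) = N *\<^sub>R m"
    using assms N by (simp add: m_def mean_out_def N_def)
  have m': "mean_out (add_mset (x, y) D) = (1 / (N + 1)) *\<^sub>R (y + N *\<^sub>R m)"
    using assms sum by (simp add: mean_out_def N_def add_ac)
  have "cov_est a (add_mset (x, y) D) =
     (1 / (N + 1)) *\<^sub>R (outer_prod y + S) - outer_prod ((1 / (N + 1)) *\<^sub>R (y + N *\<^sub>R m)) + a *\<^sub>R mat 1"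
    unfolding cov_est_def m' using assms by (simp add: S_def N_def add_ac)
  moreover have "cov_est (a * (N + 1) / N) D = (1 / N) *\<^sub>R S - outer_prod m + (a * (N + 1) / N) *\<^sub>R mat 1"
    unfolding cov_est_def using assms by (simp add: S_def N_def m_def)
  moreover have "N + 1 \<noteq> 0" using N by simp
  ultimately show ?thesis
    unfolding N_def[symmetric] m_def[symmetric] using N
    by (simp add: vec_eq_iff outer_prod_def mat_def) (simp add: divide_simps, simp add: algebra_simps)
qed

text \<open>Dropping the positive semidefinite rank-one term of the update gives the matrix
  comparison that \<open>inv_sqrt_antimono\<close> inverts.\<close>

lemma inv_sqrt_cov_est_add_mset_le:
  assumes D: "size D = n" "n \<ge> 1" and a: "a > 0"
  shows "norm (inv_sqrt (cov_est a (add_mset (x, y) D)) *v v)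
    \<le> sqrt ((real n + 1) / real n) * norm (inv_sqrt (cov_est (a * (real n + 1) / real n) D) *v v)"
proof (rule inv_sqrt_antimono)
  let ?B = "cov_est (a * (real n + 1) / real n) D"
  show "pd_matrix ?B" "pd_matrix (cov_est a (add_mset (x, y) D))"
    using D a by (auto intro!: pd_matrix_cov_est)
  fix v
  have "(real n + 1) / real n * (v \<bullet> (cov_est a (add_mset (x, y) D) *v v))
     = v \<bullet> (?B *v v) + 1 / (real n + 1) * ((y - mean_out D) \<bullet> v)\<^sup>2"
    unfolding cov_est_add_mset[OF D] using D
    by (simp add: matrix_vector_mult_add_rdistrib scaleR_matrix_vector_assoc[symmetric]
        inner_add_right outer_prod_mult_vec power2_eq_square inner_commute)
  then show "v \<bullet> (?B *v v) \<le> (real n + 1) / real n * (v \<bullet> (cov_est a (add_mset (x, y) D) *v v))"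
    by simp
qed simp

text \<open>Now the rank-one term is bounded from above: by duality its form is at most
  \<open>q^2\<close> times that of \<open>B\<close>. Any upper bound \<open>q\<close> is allowed, so
  that the computable quantity in the denominator of \<open>score_lo\<close> can be
  inserted.\<close>

lemma inv_sqrt_cov_est_add_mset_ge:
  assumes D: "size D = n" "n \<ge> 1" and a: "a > 0"
    and B: "B = cov_est (a * (real n + 1) / real n) D"
    and q: "norm (inv_sqrt B *v (y - mean_out D)) \<le> q"
  shows "sqrt ((real n + 1) / real n) * norm (inv_sqrt B *v v) / sqrt (1 + 1 / (real n + 1) * q\<^sup>2)
    \<le> norm (inv_sqrt (cov_est a (add_mset (x, y) D)) *v v)"
proof -
  let ?A = "cov_est a (add_mset (x, y) D)" and ?w = "y - mean_out D"
  let ?k = "real n / (real n + 1) * (1 + 1 / (real n + 1) * q\<^sup>2)"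
  have pd: "pd_matrix B" "pd_matrix ?A"
    using D a unfolding B by (auto intro!: pd_matrix_cov_est)
  have "norm (inv_sqrt B *v v) \<le> sqrt ?k * norm (inv_sqrt ?A *v v)"
  proof (rule inv_sqrt_antimono[OF pd])
    fix v
    have "\<bar>?w \<bullet> v\<bar> \<le> q * norm (matrix_sqrt B *v v)"
      using inner_le_inv_sqrt[OF pd(1), of ?w v] mult_right_mono[OF q, of "norm (matrix_sqrt B *v v)"]
      by simp
    then have "\<bar>?w \<bullet> v\<bar>\<^sup>2 \<le> (q * norm (matrix_sqrt B *v v))\<^sup>2" by (rule power_mono) simp
    then have "(?w \<bullet> v)\<^sup>2 \<le> q\<^sup>2 * (v \<bullet> (B *v v))"
      by (simp add: power_mult_distrib norm_matrix_sqrt_sq[OF pd(1)])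
    then have "v \<bullet> (B *v v) + 1 / (real n + 1) * (?w \<bullet> v)\<^sup>2
        \<le> v \<bullet> (B *v v) + 1 / (real n + 1) * (q\<^sup>2 * (v \<bullet> (B *v v)))"
      by (intro add_left_mono mult_left_mono) auto
    then have "real n / (real n + 1) * (v \<bullet> (B *v v) + 1 / (real n + 1) * (?w \<bullet> v)\<^sup>2)
        \<le> real n / (real n + 1) * (v \<bullet> (B *v v) + 1 / (real n + 1) * (q\<^sup>2 * (v \<bullet> (B *v v))))"
      by (intro mult_left_mono) auto
    moreover have "v \<bullet> (?A *v v) = real n / (real n + 1) * (v \<bullet> (B *v v) + 1 / (real n + 1) * (?w \<bullet> v)\<^sup>2)"
      unfolding cov_est_add_mset[OF D] B[symmetric]
      by (simp add: matrix_vector_mult_add_rdistrib scaleR_matrix_vector_assoc[symmetric]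
          inner_add_right outer_prod_mult_vec power2_eq_square inner_commute)
    ultimately show "v \<bullet> (?A *v v) \<le> ?k * (v \<bullet> (B *v v))" by (simp add: algebra_simps)
  qed simp
  moreover define s where "s = sqrt (1 + 1 / (real n + 1) * q\<^sup>2)"
  moreover have "s > 0" by (simp add: s_def add_pos_nonneg)
  moreover define r where "r = sqrt ((real n + 1) / real n)"
  moreover have "sqrt ?k = s / r" "r > 0"
    using D by (auto simp: s_def r_def real_sqrt_mult real_sqrt_divide)
  ultimately have "norm (inv_sqrt B *v v) \<le> s / r * norm (inv_sqrt ?A *v v)" by simp
  then show ?thesis unfolding s_def[symmetric] r_def[symmetric]
    using \<open>s > 0\<close> \<open>r > 0\<close> by (simp add: field_simps)
qed

section \<open>Regularized risk minimization in a reproducing kernel Hilbert space\<close>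

lemma norm_mult_vec_le_op_norm: "norm (A *v w) \<le> op_norm A * norm w"
  unfolding op_norm_def by (rule onorm) (rule matrix_vector_mul_bounded_linear)

lemma op_norm_nonneg: "op_norm A \<ge> 0"
  unfolding op_norm_def by (rule onorm_pos_le) (rule matrix_vector_mul_bounded_linear)

section \<open>Hilbert space geometry and evaluation bounds\<close>

context rkhs
begin

abbreviation hnorm :: "(real^'d \<Rightarrow> real^'p) \<Rightarrow> real"
  where "hnorm f \<equiv> sqrt (ip f f)"

lemma diff_closed:
  assumes "f \<in> \<H>" "g \<in> \<H>"
  shows "(\<lambda>x. f x - g x) \<in> \<H>"
  using add_closed[OF assms(1) scale_closed[OF assms(2), of "-1"]] by simp

lemma ip_scale_right: "f \<in> \<H> \<Longrightarrow> g \<in> \<H> \<Longrightarrow> ip f (\<lambda>x. c *\<^sub>R g x) = c * ip f g"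
  by (simp add: ip_commute[of f] ip_scale scale_closed)

lemma ip_add_right: "f \<in> \<H> \<Longrightarrow> g \<in> \<H> \<Longrightarrow> h \<in> \<H> \<Longrightarrow> ip f (\<lambda>x. g x + h x) = ip f g + ip f h"
  by (simp add: ip_commute[of f] ip_add add_closed)

lemma ip_combination:
  assumes "f \<in> \<H>" "g \<in> \<H>"
  shows "ip (\<lambda>x. s *\<^sub>R f x + t *\<^sub>R g x) (\<lambda>x. s *\<^sub>R f x + t *\<^sub>R g x)
    = s\<^sup>2 * ip f f + 2 * s * t * ip f g + t\<^sup>2 * ip g g"
  using assms ip_commute[of g f]
  by (simp add: ip_add ip_add_right ip_scale ip_scale_right add_closed scale_closed
      power2_eq_square algebra_simps)

lemma ip_diff:
  assumes "f \<in> \<H>" "g \<in> \<H>"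
  shows "ip (\<lambda>x. f x - g x) (\<lambda>x. f x - g x) = ip f f - 2 * ip f g + ip g g"
  using ip_combination[OF assms, of 1 "-1"] by simp

text \<open>The last term of this exact identity is the source of strong convexity of the
  regularizer.\<close>

lemma ip_convex_combination:
  assumes "f \<in> \<H>" "g \<in> \<H>"
  shows "ip (\<lambda>x. (1 - t) *\<^sub>R f x + t *\<^sub>R g x) (\<lambda>x. (1 - t) *\<^sub>R f x + t *\<^sub>R g x)
    = (1 - t) * ip f f + t * ip g g - t * (1 - t) * ip (\<lambda>x. g x - f x) (\<lambda>x. g x - f x)"
  unfolding ip_combination[OF assms] ip_diff[OF assms(2,1)] ip_commute[OF assms(2,1)]
  by (simp add: power2_eq_square algebra_simps)

lemma ip_Cauchy_Schwarz:
  assumes f: "f \<in> \<H>" and g: "g \<in> \<H>"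
  shows "\<bar>ip f g\<bar> \<le> hnorm f * hnorm g"
proof -
  have nn: "s\<^sup>2 * ip f f + 2 * s * t * ip f g + t\<^sup>2 * ip g g \<ge> 0" for s t
    unfolding ip_combination[OF f g, symmetric] using f g by (intro ip_nonneg add_closed scale_closed)
  have gg: "ip g g \<ge> 0" using g by (rule ip_nonneg)
  have "(ip f g)\<^sup>2 \<le> ip f f * ip g g"
  proof (cases "ip g g = 0")
    case True
    then have "g = (\<lambda>x. 0)" using ip_definite g by blast
    then have "ip f g = 0" using ip_scale_right[OF f zero_closed, of 0] by simp
    then show ?thesis using True by simp
  next
    case False
    \<comment> \<open>The choice \<open>s = ip g g\<close>, \<open>t = - ip f g\<close> is, up to
      scaling, the residual of projecting \<open>f\<close> onto \<open>g\<close>.\<close>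
    have "0 \<le> (ip g g)\<^sup>2 * ip f f + 2 * ip g g * (- ip f g) * ip f g + (- ip f g)\<^sup>2 * ip g g" by (rule nn)
    also have "\<dots> = ip g g * (ip f f * ip g g - (ip f g)\<^sup>2)"
      by (simp add: power2_eq_square algebra_simps)
    finally show ?thesis using False gg by (simp add: zero_le_mult_iff)
  qed
  then have "sqrt ((ip f g)\<^sup>2) \<le> sqrt (ip f f * ip g g)" by (rule real_sqrt_le_mono)
  then show ?thesis by (simp add: real_sqrt_mult)
qed

lemma ip_kernel_section:
  assumes "x \<in> \<X>"
  shows "ip (kernel_section \<X> K x v) (kernel_section \<X> K x v) = v \<bullet> (K x x *v v)"
  using reproducing[OF assms kernel_in[OF assms], of v v] assms by (simp add: kernel_section_def)

text \<open>Pair \<open>w = G *v g x\<close> with itself: by the reproducing property its squared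
  norm is the inner product of \<open>g\<close> with the kernel section in direction
  \<open>v\<close>, whose norm is controlled by the conjugated kernel; then cancel one norm of
  \<open>w\<close>. A whitening \<open>G\<close> gives the first factor of \<open>tau\<close>, and
  the identity gives the kernel factor in the stability bound.\<close>

lemma norm_eval_le:
  assumes x: "x \<in> \<X>" and g: "g \<in> \<H>"
  shows "norm (G *v g x) \<le> sqrt (op_norm (G ** K x x ** transpose G)) * hnorm g"
proof -
  define w where "w = G *v g x"
  define v where "v = transpose G *v w"
  let ?o = "op_norm (G ** K x x ** transpose G)"
  have "v \<bullet> (K x x *v v) = w \<bullet> ((G ** K x x ** transpose G) *v w)"
    unfolding v_def transpose_matrix_vector dot_lmul_matrix
    by (simp add: matrix_vector_mul_assoc[symmetric])
  also have "\<dots> \<le> norm w * norm ((G ** K x x ** transpose G) *v w)"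
    by (rule norm_cauchy_schwarz)
  also have "\<dots> \<le> norm w * (?o * norm w)"
    by (intro mult_left_mono norm_mult_vec_le_op_norm) auto
  finally have "v \<bullet> (K x x *v v) \<le> ?o * (norm w)\<^sup>2" by (simp add: power2_eq_square mult_ac)
  then have k: "hnorm (kernel_section \<X> K x v) \<le> sqrt ?o * norm w"
    unfolding ip_kernel_section[OF x] using real_sqrt_le_mono by (fastforce simp: real_sqrt_mult)
  have "norm w * norm w = v \<bullet> g x"
    unfolding v_def transpose_matrix_vector dot_lmul_matrix
    by (simp add: w_def[symmetric] dot_square_norm power2_eq_square)
  also have "\<dots> = ip (kernel_section \<X> K x v) g" using reproducing[OF x g] by simp
  also have "\<dots> \<le> hnorm (kernel_section \<X> K x v) * hnorm g"
    using ip_Cauchy_Schwarz[OF kernel_in[OF x, of v] g] by simp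
  also have "\<dots> \<le> sqrt ?o * norm w * hnorm g"
    using k ip_nonneg[OF g] by (intro mult_right_mono) auto
  finally have "norm w * norm w \<le> (sqrt ?o * hnorm g) * norm w" by (simp add: mult_ac)
  then show ?thesis unfolding w_def[symmetric]
    using ip_nonneg[OF g] op_norm_nonneg[of "G ** K x x ** transpose G"]
    by (cases "norm w = 0") (simp_all add: mult_le_cancel_right)
qed

lemma norm_eval_le_op_norm_kernel:
  assumes "x \<in> \<X>" "g \<in> \<H>"
  shows "norm (g x) \<le> sqrt (op_norm (K x x)) * hnorm g"
  using norm_eval_le[OF assms, of "mat 1"] by simp

lemma tendsto_eval:
  assumes x: "x \<in> \<X>" and F: "\<And>k. F k \<in> \<H>" and f: "f \<in> \<H>"
    and lim: "(\<lambda>k. hnorm (\<lambda>x. F k x - f x)) \<longlonglongrightarrow> 0"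
  shows "(\<lambda>k. F k x) \<longlonglongrightarrow> f x"
proof -
  have "(\<lambda>k. sqrt (op_norm (K x x)) * hnorm (\<lambda>x. F k x - f x)) \<longlonglongrightarrow> sqrt (op_norm (K x x)) * 0"
    by (intro tendsto_intros lim)
  then have "(\<lambda>k. sqrt (op_norm (K x x)) * hnorm (\<lambda>x. F k x - f x)) \<longlonglongrightarrow> 0" by simp
  then have "(\<lambda>k. F k x - f x) \<longlonglongrightarrow> 0"
    by (rule Lim_null_comparison[rotated]) (simp add: norm_eval_le_op_norm_kernel[OF x diff_closed[OF F f]])
  then show ?thesis by (rule LIM_zero_cancel)
qed

lemma tendsto_ip_self:
  assumes F: "\<And>k. F k \<in> \<H>" and f: "f \<in> \<H>"
    and lim: "(\<lambda>k. hnorm (\<lambda>x. F k x - f x)) \<longlonglongrightarrow> 0"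
  shows "(\<lambda>k. ip (F k) (F k)) \<longlonglongrightarrow> ip f f"
proof -
  let ?d = "\<lambda>k x. F k x - f x"
  have d: "?d k \<in> \<H>" for k by (rule diff_closed[OF F f])
  have "(\<lambda>k. hnorm (?d k) * hnorm f) \<longlonglongrightarrow> 0 * hnorm f" by (intro tendsto_intros lim)
  then have "(\<lambda>k. hnorm (?d k) * hnorm f) \<longlonglongrightarrow> 0" by simp
  then have 1: "(\<lambda>k. ip (?d k) f) \<longlonglongrightarrow> 0"
    by (rule Lim_null_comparison[rotated]) (simp add: ip_Cauchy_Schwarz[OF d f])
  have "(\<lambda>k. (hnorm (?d k))\<^sup>2) \<longlonglongrightarrow> 0\<^sup>2" by (intro tendsto_intros lim)
  then have 2: "(\<lambda>k. ip (?d k) (?d k)) \<longlonglongrightarrow> 0" using ip_nonneg[OF d] by simp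
  have "(\<lambda>k. ip (?d k) (?d k) + 2 * ip (?d k) f + ip f f) \<longlonglongrightarrow> 0 + 2 * 0 + ip f f"
    by (intro tendsto_intros 1 2)
  moreover have "ip (?d k) (?d k) + 2 * ip (?d k) f + ip f f = ip (F k) (F k)" for k
    using ip_combination[OF d[of k] f, of 1 1] by simp
  ultimately show ?thesis by simp
qed

section \<open>Minimizing a convex, bounded below, continuous functional plus a squared norm\<close>

context
  fixes L :: "(real^'d \<Rightarrow> real^'p) \<Rightarrow> real" and lam b :: real
  assumes L_convex: "\<And>f g t. f \<in> \<H> \<Longrightarrow> g \<in> \<H> \<Longrightarrow> 0 \<le> t \<Longrightarrow> t \<le> 1 \<Longrightarrow>
            L (\<lambda>x. (1 - t) *\<^sub>R f x + t *\<^sub>R g x) \<le> (1 - t) * L f + t * L g"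
    and L_bounded: "\<And>f. f \<in> \<H> \<Longrightarrow> L f \<ge> b"
    and L_continuous: "\<And>F f. (\<And>k. F k \<in> \<H>) \<Longrightarrow> f \<in> \<H> \<Longrightarrow>
            (\<lambda>k. hnorm (\<lambda>x. F k x - f x)) \<longlonglongrightarrow> 0 \<Longrightarrow> (\<lambda>k. L (F k)) \<longlonglongrightarrow> L f"
    and lam_pos: "lam > 0"
begin

lemma regularized_convex:
  assumes f: "f \<in> \<H>" and g: "g \<in> \<H>" and t: "0 \<le> t" "t \<le> 1"
    and h: "h = (\<lambda>x. (1 - t) *\<^sub>R f x + t *\<^sub>R g x)"
  shows "L h + lam * ip h h \<le> (1 - t) * (L f + lam * ip f f) + t * (L g + lam * ip g g)
     - lam * (t * (1 - t)) * ip (\<lambda>x. g x - f x) (\<lambda>x. g x - f x)"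
  using L_convex[OF f g t] unfolding h ip_convex_combination[OF f g] by (simp add: algebra_simps)

text \<open>Quadratic growth at a minimizer: compare it with points of the segment towards
  \<open>g\<close> that approach it.\<close>

lemma regularized_min_strong:
  assumes f: "f \<in> \<H>" and min: "\<And>h. h \<in> \<H> \<Longrightarrow> L f + lam * ip f f \<le> L h + lam * ip h h"
    and g: "g \<in> \<H>"
  shows "L f + lam * ip f f + lam * ip (\<lambda>x. g x - f x) (\<lambda>x. g x - f x) \<le> L g + lam * ip g g"
proof -
  let ?R = "\<lambda>f. L f + lam * ip f f" and ?d = "ip (\<lambda>x. g x - f x) (\<lambda>x. g x - f x)"
  have "lam * ?d \<le> ?R g - ?R f"
  \<comment> \<open>Proving the bound with a factor \<open>s\<close> for all \<open>s\<close> in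
    (0,1) replaces the limit as \<open>s\<close>, the weight of \<open>f\<close> in
    \<open>h\<close>, tends to 1.\<close>
  proof (rule field_le_mult_one_interval)
    fix s :: real assume s: "0 < s" "s < 1"
    define h where "h = (\<lambda>x. (1 - (1 - s)) *\<^sub>R f x + (1 - s) *\<^sub>R g x)"
    have "h \<in> \<H>" unfolding h_def using f g by (intro add_closed scale_closed)
    from min[OF this] have "?R f \<le> s * ?R f + (1 - s) * ?R g - lam * ((1 - s) * s) * ?d"
      using regularized_convex[OF f g _ _ h_def] s by simp
    then have "0 \<le> (1 - s) * (?R g - ?R f - s * (lam * ?d))" by (simp add: algebra_simps)
    then show "s * (lam * ?d) \<le> ?R g - ?R f" using s by (simp only: zero_le_mult_iff) linarith
  qed
  then show ?thesis by simp
qed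

text \<open>The direct method: since midpoints cannot fall below the infimum, strong convexity makes
  every minimizing sequence Cauchy, and completeness with continuity supplies the minimizer.\<close>

lemma regularized_min_exists: "\<exists>f\<in>\<H>. \<forall>h\<in>\<H>. L f + lam * ip f f \<le> L h + lam * ip h h"
proof -
  let ?R = "\<lambda>f. L f + lam * ip f f"
  define I where "I = Inf (?R ` \<H>)"
  have Rb: "?R h \<ge> b" if "h \<in> \<H>" for h
    using L_bounded[OF that] ip_nonneg[OF that] lam_pos by (simp add: add_increasing2)
  then have bdd: "bdd_below (?R ` \<H>)" by (rule bdd_belowI2)
  have I: "I \<le> ?R h" if "h \<in> \<H>" for h
    unfolding I_def using that bdd by (intro cInf_lower) auto
  have "\<exists>h\<in>\<H>. ?R h < I + 1 / (real k + 1)" for k :: nat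
    using cInf_lessD[of "?R ` \<H>" "I + 1 / (real k + 1)"] zero_closed unfolding I_def by auto
  then obtain F where F: "\<And>k. F k \<in> \<H>" "\<And>k. ?R (F k) < I + 1 / (real k + 1)" by metis
  let ?d = "\<lambda>j k. ip (\<lambda>x. F j x - F k x) (\<lambda>x. F j x - F k x)"
  have d: "lam * ?d j k \<le> 2 / (real j + 1) + 2 / (real k + 1)" for j k
  proof -
    \<comment> \<open>At the midpoint the gain from strong convexity is \<open>lam / 4\<close> times
      the squared distance.\<close>
    define h where "h = (\<lambda>x. (1 - 1/2) *\<^sub>R F k x + (1/2) *\<^sub>R F j x)"
    have "h \<in> \<H>" unfolding h_def using F by (intro add_closed scale_closed)
    then have "I \<le> ?R h" by (rule I)
    also have "\<dots> \<le> (?R (F k) + ?R (F j)) / 2 - lam / 4 * ?d j k"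
      using regularized_convex[OF F(1)[of k] F(1)[of j] _ _ h_def] by (simp add: add_divide_distrib)
    finally have "lam * ?d j k \<le> 2 * (1 / (real j + 1)) + 2 * (1 / (real k + 1))"
      using F(2)[of j] F(2)[of k] by argo
    then show ?thesis by simp
  qed
  have "\<exists>f\<in>\<H>. (\<lambda>k. hnorm (\<lambda>x. F k x - f x)) \<longlonglongrightarrow> 0"
  proof (rule complete[OF F(1)], intro allI impI)
    fix e :: real assume e: "e > 0"
    define N where "N = nat \<lceil>4 / (lam * e\<^sup>2)\<rceil>"
    have N: "4 / (lam * e\<^sup>2) < real N + 1" unfolding N_def by linarith
    have "hnorm (\<lambda>x. F j x - F k x) < e" if jk: "j \<ge> N" "k \<ge> N" for j k
    proof -
      have "2 / (real j + 1) \<le> 2 / (real N + 1)" "2 / (real k + 1) \<le> 2 / (real N + 1)"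
        using jk by (auto intro!: divide_left_mono)
      then have "lam * ?d j k \<le> 4 / (real N + 1)" using d[of j k] by simp
      also have "\<dots> < lam * e\<^sup>2" using N e lam_pos by (simp add: field_simps)
      finally have "?d j k < e\<^sup>2" using lam_pos by simp
      then show ?thesis using e by (simp add: real_less_lsqrt)
    qed
    then show "\<exists>N. \<forall>j\<ge>N. \<forall>k\<ge>N. hnorm (\<lambda>x. F j x - F k x) < e" by blast
  qed
  then obtain f where f: "f \<in> \<H>" and lim: "(\<lambda>k. hnorm (\<lambda>x. F k x - f x)) \<longlonglongrightarrow> 0" by blast
  have "(\<lambda>k. ?R (F k)) \<longlonglongrightarrow> ?R f"
    by (intro tendsto_intros tendsto_ip_self[OF F(1) f lim] L_continuous[OF F(1) f lim])
  moreover have "(\<lambda>k. I + 1 / (real k + 1)) \<longlonglongrightarrow> I + 0"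
    using lim_1_over_n[THEN LIMSEQ_Suc] by (intro tendsto_intros) (simp add: add_ac)
  ultimately have "?R f \<le> I + 0"
    by (rule LIMSEQ_le) (use F(2) less_imp_le in blast)
  then show ?thesis using f I by force
qed

end

end

section \<open>Existence, uniqueness and stability of the regularized fits\<close>

locale rkhs_loss = rkhs \<X> \<H> ip K
  for \<X> :: "(real^'d) set" and \<H> :: "(real^'d \<Rightarrow> real^'p) set" and ip K +
  fixes \<Y> :: "(real^'p) set" and loss :: "real^'p \<Rightarrow> real^'p \<Rightarrow> real" and \<rho> c :: real
  assumes loss_convex: "\<And>y. y \<in> \<Y> \<Longrightarrow> convex_on UNIV (\<lambda>u. loss y u)"
    and loss_lipschitz: "\<And>y. y \<in> \<Y> \<Longrightarrow> \<rho>-lipschitz_on UNIV (\<lambda>u. loss y u)"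
    and loss_bounded_below: "\<And>y u. loss y u \<ge> c"
begin

lemma empirical_loss_convex:
  assumes D: "set_mset D \<subseteq> \<X> \<times> \<Y>" and t: "0 \<le> t" "t \<le> 1"
  shows "(\<Sum>(x, y)\<in>#D. loss y ((1 - t) *\<^sub>R f x + t *\<^sub>R g x))
     \<le> (1 - t) * (\<Sum>(x, y)\<in>#D. loss y (f x)) + t * (\<Sum>(x, y)\<in>#D. loss y (g x))"
  using D
proof (induction D)
  case (add z D)
  obtain x y where z: "z = (x, y)" by force
  have "y \<in> \<Y>" using add.prems z by auto
  then have "loss y ((1 - t) *\<^sub>R f x + t *\<^sub>R g x) \<le> (1 - t) * loss y (f x) + t * loss y (g x)"
    using convex_onD[OF loss_convex] t by blast
  then show ?case using add by (simp add: z algebra_simps)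
qed simp

lemma empirical_loss_bounded_below: "real (size D) * c \<le> (\<Sum>(x, y)\<in>#D. loss y (f x))"
proof (induction D)
  case (add z D)
  then show ?case using loss_bounded_below[of "snd z" "f (fst z)"]
    by (simp add: case_prod_unfold algebra_simps)
qed simp

lemma empirical_loss_tendsto:
  assumes D: "set_mset D \<subseteq> \<X> \<times> \<Y>" and F: "\<And>k. F k \<in> \<H>" and f: "f \<in> \<H>"
    and lim: "(\<lambda>k. hnorm (\<lambda>x. F k x - f x)) \<longlonglongrightarrow> 0"
  shows "(\<lambda>k. \<Sum>(x, y)\<in>#D. loss y (F k x)) \<longlonglongrightarrow> (\<Sum>(x, y)\<in>#D. loss y (f x))"
  using D
proof (induction D)
  case (add z D)
  obtain x y where z: "z = (x, y)" by force
  have xy: "x \<in> \<X>" "y \<in> \<Y>" using add.prems z by auto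
  have "isCont (loss y) (f x)"
    using lipschitz_on_continuous_on[OF loss_lipschitz[OF xy(2)]]
    by (simp add: continuous_on_eq_continuous_at)
  then have "(\<lambda>k. loss y (F k x)) \<longlonglongrightarrow> loss y (f x)"
    using tendsto_eval[OF xy(1) F f lim] by (rule isCont_tendsto_compose)
  then show ?case using add by (auto simp: z intro!: tendsto_add)
qed simp

text \<open>Existence and uniqueness make the description in \<open>fit\<close> denote the
  minimizer. The second conclusion keeps the quadratic gap, which drives the stability
  bound.\<close>

lemma fit_minimizes:
  assumes D: "set_mset D \<subseteq> \<X> \<times> \<Y>" and lam: "lam > 0"
  shows "fit \<H> ip loss lam D \<in> \<H>"
    and "g \<in> \<H> \<Longrightarrow> reg_risk ip loss lam D (fit \<H> ip loss lam D)
        + lam * ip (\<lambda>x. g x - fit \<H> ip loss lam D x) (\<lambda>x. g x - fit \<H> ip loss lam D x)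
      \<le> reg_risk ip loss lam D g"
proof -
  define L where "L f = 1 / real (size D) * (\<Sum>(x, y)\<in>#D. loss y (f x))" for f
  have R: "reg_risk ip loss lam D = (\<lambda>f. L f + lam * ip f f)"
    by (simp add: reg_risk_def L_def fun_eq_iff)
  have L1: "L (\<lambda>x. (1 - t) *\<^sub>R f x + t *\<^sub>R g x) \<le> (1 - t) * L f + t * L g"
    if "f \<in> \<H>" "g \<in> \<H>" "0 \<le> t" "t \<le> 1" for f g t
  proof -
    have "L (\<lambda>x. (1 - t) *\<^sub>R f x + t *\<^sub>R g x) \<le> 1 / real (size D) *
       ((1 - t) * (\<Sum>(x, y)\<in>#D. loss y (f x)) + t * (\<Sum>(x, y)\<in>#D. loss y (g x)))"
      unfolding L_def by (intro mult_left_mono empirical_loss_convex[OF D] that) auto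
    also have "\<dots> = (1 - t) * L f + t * L g"
      unfolding L_def by (simp only: distrib_left mult.left_commute)
    finally show ?thesis .
  qed
  \<comment> \<open>The bound is not reduced to \<open>c\<close>: for the empty data set both sides
    are 0.\<close>
  have L2: "1 / real (size D) * (real (size D) * c) \<le> L f" if "f \<in> \<H>" for f
    unfolding L_def by (intro mult_left_mono empirical_loss_bounded_below) auto
  have L3: "(\<lambda>k. L (F k)) \<longlonglongrightarrow> L f"
    if "\<And>k. F k \<in> \<H>" "f \<in> \<H>" "(\<lambda>k. hnorm (\<lambda>x. F k x - f x)) \<longlonglongrightarrow> 0" for F f
    unfolding L_def by (intro tendsto_intros empirical_loss_tendsto[OF D that])
  obtain f where f: "f \<in> \<H>" "\<And>h. h \<in> \<H> \<Longrightarrow> L f + lam * ip f f \<le> L h + lam * ip h h"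
    using regularized_min_exists[of L _ lam, OF L1 L2 L3 lam] by blast
  have strong: "L f + lam * ip f f + lam * ip (\<lambda>x. g x - f x) (\<lambda>x. g x - f x) \<le> L g + lam * ip g g"
    if "g \<in> \<H>" for g
    using regularized_min_strong[of L _ lam, OF L1 L2 L3 lam f that] by blast
  have "fit \<H> ip loss lam D = f"
    unfolding fit_def R
  proof (rule the_equality)
    show "is_arg_min (\<lambda>f. L f + lam * ip f f) (\<lambda>f. f \<in> \<H>) f"
      using f by (simp add: is_arg_min_linorder)
  next
    fix g assume "is_arg_min (\<lambda>f. L f + lam * ip f f) (\<lambda>f. f \<in> \<H>) g"
    then have g: "g \<in> \<H>" "L g + lam * ip g g \<le> L f + lam * ip f f"
      using f by (auto simp: is_arg_min_linorder)
    then have "lam * ip (\<lambda>x. g x - f x) (\<lambda>x. g x - f x) \<le> 0" using strong[OF g(1)] by simp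
    moreover have gf: "(\<lambda>x. g x - f x) \<in> \<H>" by (rule diff_closed[OF g(1) f(1)])
    ultimately have "ip (\<lambda>x. g x - f x) (\<lambda>x. g x - f x) = 0"
      using ip_nonneg[OF gf] lam by (simp add: mult_le_0_iff)
    then have "(\<lambda>x. g x - f x) = (\<lambda>x. 0)" by (rule ip_definite[OF gf])
    then show "g = f" by (simp add: fun_eq_iff)
  qed
  then show "fit \<H> ip loss lam D \<in> \<H>"
    and "g \<in> \<H> \<Longrightarrow> reg_risk ip loss lam D (fit \<H> ip loss lam D)
        + lam * ip (\<lambda>x. g x - fit \<H> ip loss lam D x) (\<lambda>x. g x - fit \<H> ip loss lam D x)
      \<le> reg_risk ip loss lam D g"
    using f(1) strong by (simp_all add: R)
qed

text \<open>\<open>lam_plus\<close> is chosen so that the two objectives, the second one rescaled by \<open>n/(n+1)\<close>, differ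
  by the single loss term \<open>loss y (f x) / (n+1)\<close>; adding the strong convexity inequalities of both
  minimizers leaves only its increment.\<close>

lemma fit_add_mset_stability:
  assumes D: "set_mset D \<subseteq> \<X> \<times> \<Y>" "size D = n" "n \<ge> 1" and x: "x \<in> \<X>" and y: "y \<in> \<Y>"
    and lam: "lam > 0"
  defines "f \<equiv> fit \<H> ip loss lam (add_mset (x, y) D)"
    and "g \<equiv> fit \<H> ip loss (lam_plus n lam) D"
  shows "hnorm (\<lambda>x. f x - g x) \<le> \<rho> * sqrt (op_norm (K x x)) / (2 * lam * (real n + 1))"
proof -
  have D': "set_mset (add_mset (x, y) D) \<subseteq> \<X> \<times> \<Y>" using D x y by auto
  have lp: "lam_plus n lam > 0" using D lam by (simp add: lam_plus_def)
  have f: "f \<in> \<H>" and g: "g \<in> \<H>"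
    unfolding f_def g_def using fit_minimizes(1)[OF D' lam] fit_minimizes(1)[OF D(1) lp] .
  have fg: "(\<lambda>x. f x - g x) \<in> \<H>" by (rule diff_closed[OF f g])
  let ?d = "ip (\<lambda>x. f x - g x) (\<lambda>x. f x - g x)" and ?N = "real n + 1"
  define S where "S h = (\<Sum>(x, y)\<in>#D. loss y (h x))" for h
  have "ip (\<lambda>x. g x - f x) (\<lambda>x. g x - f x) = ?d"
    using ip_diff[OF f g] ip_diff[OF g f] ip_commute[OF f g] by simp
  then have "1 / ?N * (loss y (f x) + S f) + lam * ip f f + lam * ?d \<le> 1 / ?N * (loss y (g x) + S g) + lam * ip g g"
    using fit_minimizes(2)[OF D' lam g] D(2) unfolding f_def[symmetric] reg_risk_def S_def
    by (simp add: add_ac)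
  \<comment> \<open>Scaling this inequality by \<open>n+1\<close> and the next one by
    \<open>n\<close> gives both the same weight \<open>(n+1) * lam\<close>, so all terms but the
    extra loss and the distances cancel in the sum.\<close>
  from mult_left_mono[OF this, of ?N]
  have 1: "loss y (f x) + S f + ?N * (lam * ip f f) + ?N * (lam * ?d) \<le> loss y (g x) + S g + ?N * (lam * ip g g)"
    by (simp add: distrib_left)
  have "1 / real n * S g + ?N / real n * lam * ip g g + ?N / real n * lam * ?d \<le> 1 / real n * S f + ?N / real n * lam * ip f f"
    using fit_minimizes(2)[OF D(1) lp f, folded g_def, unfolded reg_risk_def D(2), folded S_def]
    by (simp add: lam_plus_def)
  from mult_left_mono[OF this, of "real n"]
  have 2: "S g + ?N * (lam * ip g g) + ?N * (lam * ?d) \<le> S f + ?N * (lam * ip f f)"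
    using D(3) by (simp add: distrib_left)
  have "dist (loss y (g x)) (loss y (f x)) \<le> \<rho> * dist (g x) (f x)"
    using loss_lipschitz[OF y] by (simp add: lipschitz_on_def)
  then have "loss y (g x) - loss y (f x) \<le> \<rho> * norm (f x - g x)"
    by (simp add: dist_norm norm_minus_commute)
  also have "\<dots> \<le> \<rho> * (sqrt (op_norm (K x x)) * hnorm (\<lambda>x. f x - g x))"
    using norm_eval_le_op_norm_kernel[OF x fg] lipschitz_on_nonneg[OF loss_lipschitz[OF y]]
    by (intro mult_left_mono) auto
  finally have "2 * (?N * (lam * ?d)) \<le> \<rho> * (sqrt (op_norm (K x x)) * hnorm (\<lambda>x. f x - g x))"
    using 1 2 by linarith
  \<comment> \<open>The squared distance is bounded by a multiple of the distance; one factor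
    cancels unless it is zero.\<close>
  moreover have "?d = hnorm (\<lambda>x. f x - g x) * hnorm (\<lambda>x. f x - g x)" using ip_nonneg[OF fg] by simp
  ultimately have "(2 * lam * ?N * hnorm (\<lambda>x. f x - g x)) * hnorm (\<lambda>x. f x - g x)
      \<le> (\<rho> * sqrt (op_norm (K x x))) * hnorm (\<lambda>x. f x - g x)" by (simp only: mult_ac)
  moreover have "hnorm (\<lambda>x. f x - g x) \<ge> 0" using ip_nonneg[OF fg] by simp
  moreover have "\<rho> * sqrt (op_norm (K x x)) \<ge> 0"
    using lipschitz_on_nonneg[OF loss_lipschitz[OF y]] by (simp add: op_norm_nonneg)
  ultimately have "2 * lam * ?N * hnorm (\<lambda>x. f x - g x) \<le> \<rho> * sqrt (op_norm (K x x))"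
    by (cases "hnorm (\<lambda>x. f x - g x) = 0") (simp_all add: mult_le_cancel_right)
  moreover have "2 * lam * ?N > 0" using lam by simp
  ultimately show ?thesis by (simp only: pos_le_divide_eq mult.commute)
qed

end

section \<open>Comparison of the scores\<close>

lemma size_data [simp]: "size (data n z) = n"
  by (simp add: data_def)

lemma data_cong:
  assumes "\<And>i. i \<in> {1..n+1} \<Longrightarrow> z i = w i"
  shows "data n z = data n w"
  unfolding data_def using assms by (intro image_mset_cong) auto

lemma set_mset_data_subset:
  assumes "\<And>i. i \<in> {1..n+1} \<Longrightarrow> z i \<in> A"
  shows "set_mset (data n z) \<subseteq> A"
  using assms by (auto simp: data_def)

text \<open>Bridges sequences on all of the naturals and the restricted sequences of the product
  space, in which exchangeability is expressed.\<close>

lemma full_region_cong: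
  assumes zw: "\<And>i. i \<in> {1..n+1} \<Longrightarrow> z i = w i"
  shows "full_region \<Y> \<H> ip loss lam a \<alpha> n z = full_region \<Y> \<H> ip loss lam a \<alpha> n w"
proof -
  have d: "data_aug n z = data_aug n w" and f: "z (n + 1) = w (n + 1)"
    using data_cong[OF zw] zw by (auto simp: data_aug_def fun_eq_iff)
  have "(\<Sum>i=1..n. of_bool (score \<H> ip loss lam a (data_aug n z y) (z i)
            \<ge> score \<H> ip loss lam a (data_aug n z y) (fst (z (n + 1)), y)) :: real)
      = (\<Sum>i=1..n. of_bool (score \<H> ip loss lam a (data_aug n w y) (w i)
            \<ge> score \<H> ip loss lam a (data_aug n w y) (fst (w (n + 1)), y)))" for y
    unfolding d f by (intro sum.cong refl) (simp add: zw)
  then show ?thesis unfolding full_region_def by simp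
qed

lemma up_region_cong:
  assumes zw: "\<And>i. i \<in> {1..n+1} \<Longrightarrow> z i = w i"
  shows "up_region \<Y> \<H> ip K loss \<rho> lam a \<alpha> n z = up_region \<Y> \<H> ip K loss \<rho> lam a \<alpha> n w"
proof -
  have d: "data n z = data n w" and f: "z (n + 1) = w (n + 1)"
    using data_cong[OF zw] zw by auto
  have s: "score_up \<H> ip K loss \<rho> lam a n z = score_up \<H> ip K loss \<rho> lam a n w"
    "score_lo \<H> ip K loss \<rho> lam a n z = score_lo \<H> ip K loss \<rho> lam a n w"
    unfolding score_up_def score_lo_def base_score_def t_hat_def tau_def Gam_plus_def d f by rule+
  have "(\<Sum>i=1..n. of_bool (score_up \<H> ip K loss \<rho> lam a n z (z i)
            \<ge> score_lo \<H> ip K loss \<rho> lam a n z y (fst (z (n + 1)), y)) :: real)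
      = (\<Sum>i=1..n. of_bool (score_up \<H> ip K loss \<rho> lam a n w (w i)
            \<ge> score_lo \<H> ip K loss \<rho> lam a n w y (fst (w (n + 1)), y)))" for y
    unfolding s f by (intro sum.cong refl) (simp add: zw)
  then show ?thesis unfolding up_region_def by simp
qed

context rkhs_loss
begin

context
  fixes n :: nat and lam a :: real and z :: "nat \<Rightarrow> (real^'d) \<times> (real^'p)" and y :: "real^'p"
  assumes n: "n \<ge> 1" and lam: "lam > 0" and a: "a > 0"
    and z: "\<And>i. i \<in> {1..n+1} \<Longrightarrow> z i \<in> \<X> \<times> \<Y>" and y: "y \<in> \<Y>"
begin

text \<open>The two factors of \<open>tau\<close> are the whitened evaluation bound at
  \<open>x\<close> and the stability bound in the norm of \<open>\<H>\<close>.\<close>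

lemma inv_sqrt_fit_diff_le_tau:
  assumes x: "x \<in> \<X>"
  shows "norm (inv_sqrt (Gam_plus n a z) *v (fit \<H> ip loss lam (data_aug n z y) x
      - fit \<H> ip loss (lam_plus n lam) (data n z) x)) \<le> tau K \<rho> lam a n z x"
proof -
  let ?G = "inv_sqrt (Gam_plus n a z)" and ?x = "fst (z (n + 1))"
  let ?f = "fit \<H> ip loss lam (data_aug n z y)" and ?g = "fit \<H> ip loss (lam_plus n lam) (data n z)"
  have D: "set_mset (data n z) \<subseteq> \<X> \<times> \<Y>" by (rule set_mset_data_subset[OF z])
  have x': "?x \<in> \<X>" using z[of "n + 1"] by (auto simp: mem_Times_iff)
  have "?f \<in> \<H>" unfolding data_aug_def
    by (rule fit_minimizes(1)) (use D x' y lam in auto)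
  moreover have "?g \<in> \<H>"
    by (rule fit_minimizes(1)[OF D]) (use lam n in \<open>simp add: lam_plus_def\<close>)
  ultimately have fg: "(\<lambda>x. ?f x - ?g x) \<in> \<H>" by (rule diff_closed)
  have "pd_matrix (Gam_plus n a z)" unfolding Gam_plus_def using a n by (intro pd_matrix_cov_est) simp
  then have G: "transpose ?G = ?G" by (rule inv_sqrt_symmetric)
  have "norm (?G *v (?f x - ?g x)) \<le> sqrt (op_norm (?G ** K x x ** ?G)) * hnorm (\<lambda>x. ?f x - ?g x)"
    using norm_eval_le[OF x fg, of ?G] unfolding G .
  also have "\<dots> \<le> sqrt (op_norm (?G ** K x x ** ?G)) *
      (\<rho> * sqrt (op_norm (K ?x ?x)) / (2 * lam * (real n + 1)))"
    unfolding data_aug_def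
    by (intro mult_left_mono fit_add_mset_stability D n x' y lam) (auto simp: op_norm_nonneg)
  finally show ?thesis by (simp add: tau_def Let_def)
qed

text \<open>First the fit is exchanged by the triangle inequality, at cost \<open>tau\<close>; then
  the covariance, at the cost of the square root factor.\<close>

lemma score_le_score_up:
  assumes "p \<in> \<X> \<times> \<Y>"
  shows "score \<H> ip loss lam a (data_aug n z y) p \<le> score_up \<H> ip K loss \<rho> lam a n z p"
proof -
  obtain x u where p: "p = (x, u)" by force
  have x: "x \<in> \<X>" using assms p by auto
  let ?G = "inv_sqrt (Gam_plus n a z)"
  let ?f = "fit \<H> ip loss lam (data_aug n z y)" and ?g = "fit \<H> ip loss (lam_plus n lam) (data n z)"
  have "?G *v (u - ?f x) = ?G *v (u - ?g x) - ?G *v (?f x - ?g x)"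
    by (simp add: matrix_vector_mult_diff_distrib)
  then have "norm (?G *v (u - ?f x)) \<le> norm (?G *v (u - ?g x)) + tau K \<rho> lam a n z x"
    using norm_triangle_ineq4[of "?G *v (u - ?g x)" "?G *v (?f x - ?g x)"]
      inv_sqrt_fit_diff_le_tau[OF x] by simp
  then have "sqrt ((real n + 1) / real n) * norm (?G *v (u - ?f x))
      \<le> sqrt ((real n + 1) / real n) * (norm (?G *v (u - ?g x)) + tau K \<rho> lam a n z x)"
    by (intro mult_left_mono) auto
  then show ?thesis
    using inv_sqrt_cov_est_add_mset_le[OF size_data n a, of "fst (z (n + 1))" y z "u - ?f x"]
    by (simp add: p score_def score_up_def base_score_def Gam_plus_def data_aug_def)
qed

text \<open>The same two exchanges in the other direction. The triangle inequality through the
  fitted value at the test point bounds the whitened distance of \<open>y\<close> from the mean by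
  \<open>q\<close>.\<close>

lemma score_lo_le_score:
  assumes "p \<in> \<X> \<times> \<Y>"
  shows "score_lo \<H> ip K loss \<rho> lam a n z y p \<le> score \<H> ip loss lam a (data_aug n z y) p"
proof -
  obtain x u where p: "p = (x, u)" by force
  have x: "x \<in> \<X>" using assms p by auto
  let ?G = "inv_sqrt (Gam_plus n a z)" and ?x = "fst (z (n + 1))" and ?m = "mean_out (data n z)"
  let ?f = "fit \<H> ip loss lam (data_aug n z y)" and ?g = "fit \<H> ip loss (lam_plus n lam) (data n z)"
  define q where "q = base_score \<H> ip loss lam a n z (?x, y) + t_hat \<H> ip loss lam a n z"
  have "?G *v (y - ?m) = ?G *v (y - ?g ?x) + ?G *v (?g ?x - ?m)"
    by (simp add: matrix_vector_mult_diff_distrib)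
  then have q: "norm (?G *v (y - ?m)) \<le> q"
    using norm_triangle_ineq[of "?G *v (y - ?g ?x)" "?G *v (?g ?x - ?m)"]
    by (simp add: q_def base_score_def t_hat_def)
  have "?G *v (u - ?g x) = ?G *v (u - ?f x) + ?G *v (?f x - ?g x)"
    by (simp add: matrix_vector_mult_diff_distrib)
  then have "norm (?G *v (u - ?g x)) - tau K \<rho> lam a n z x \<le> norm (?G *v (u - ?f x))"
    using norm_triangle_ineq[of "?G *v (u - ?f x)" "?G *v (?f x - ?g x)"]
      inv_sqrt_fit_diff_le_tau[OF x] by simp
  \<comment> \<open>The bracket may be negative; only the multiplier and the denominator must be
    nonnegative.\<close>
  then have "sqrt ((real n + 1) / real n) * (norm (?G *v (u - ?g x)) - tau K \<rho> lam a n z x)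
        / sqrt (1 + 1 / (real n + 1) * q\<^sup>2)
      \<le> sqrt ((real n + 1) / real n) * norm (?G *v (u - ?f x)) / sqrt (1 + 1 / (real n + 1) * q\<^sup>2)"
    by (intro divide_right_mono mult_left_mono) auto
  also have "\<dots> \<le> norm (inv_sqrt (cov_est a (add_mset (?x, y) (data n z))) *v (u - ?f x))"
    by (rule inv_sqrt_cov_est_add_mset_ge[OF size_data n a _ q]) (simp add: Gam_plus_def)
  finally show ?thesis
    by (simp add: p q_def score_def score_lo_def base_score_def data_aug_def)
qed

end

text \<open>Raising the scores of the observations and lowering that of the candidate can only
  switch further indicators on.\<close>

lemma full_region_subset_up_region:
  assumes "n \<ge> 1" "lam > 0" "a > 0" and z: "\<And>i. i \<in> {1..n+1} \<Longrightarrow> z i \<in> \<X> \<times> \<Y>"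
  shows "full_region \<Y> \<H> ip loss lam a \<alpha> n z \<subseteq> up_region \<Y> \<H> ip K loss \<rho> lam a \<alpha> n z"
proof
  fix y assume y': "y \<in> full_region \<Y> \<H> ip loss lam a \<alpha> n z"
  let ?s = "score \<H> ip loss lam a (data_aug n z y)" and ?x = "fst (z (n + 1))"
  let ?up = "score_up \<H> ip K loss \<rho> lam a n z" and ?lo = "score_lo \<H> ip K loss \<rho> lam a n z y"
  have y: "y \<in> \<Y>" using y' by (simp add: full_region_def)
  have x: "?x \<in> \<X>" using z[of "n + 1"] by (auto simp: mem_Times_iff)
  have "(\<Sum>i=1..n. of_bool (?s (z i) \<ge> ?s (?x, y))) \<le> (\<Sum>i=1..n. of_bool (?up (z i) \<ge> ?lo (?x, y)) :: real)"
  proof (rule sum_mono)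
    fix i assume "i \<in> {1..n}"
    then have "?s (z i) \<le> ?up (z i)" by (intro score_le_score_up assms y) auto
    moreover have "?lo (?x, y) \<le> ?s (?x, y)"
      by (intro score_lo_le_score assms y) (use x y in auto)
    ultimately show "of_bool (?s (z i) \<ge> ?s (?x, y)) \<le> (of_bool (?up (z i) \<ge> ?lo (?x, y)) :: real)"
      by auto
  qed
  then have "(1 + (\<Sum>i=1..n. of_bool (?s (z i) \<ge> ?s (?x, y)))) / (real n + 1)
      \<le> (1 + (\<Sum>i=1..n. of_bool (?up (z i) \<ge> ?lo (?x, y)))) / (real n + 1)"
    by (intro divide_right_mono) auto
  then show "y \<in> up_region \<Y> \<H> ip K loss \<rho> lam a \<alpha> n z"
    using y' by (auto simp: full_region_def up_region_def)
qed

end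

section \<open>Coverage of the full conformal region\<close>

text \<open>Take an index \<open>m\<close> of least score among those counted. All of them score at
  least as much as \<open>m\<close>, so they lie in a set of cardinality at most \<open>t\<close>;
  ties do no harm.\<close>

lemma card_low_rank_le:
  fixes s :: "'i \<Rightarrow> 'a::linorder" and t :: real
  assumes I: "finite I" and t: "t \<ge> 0"
  shows "real (card {j \<in> I. real (card {i \<in> I. s i \<ge> s j}) \<le> t}) \<le> t"
proof (cases "{j \<in> I. real (card {i \<in> I. s i \<ge> s j}) \<le> t} = {}")
  case False
  let ?J = "{j \<in> I. real (card {i \<in> I. s i \<ge> s j}) \<le> t}"
  have fin: "finite ?J" using I by simp
  define m where "m = arg_min_on s ?J"
  have m: "m \<in> ?J" "\<And>j. j \<in> ?J \<Longrightarrow> s m \<le> s j"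
    unfolding m_def using arg_min_if_finite(1)[OF fin False] arg_min_least[OF fin False] by auto
  then have "card ?J \<le> card {i \<in> I. s i \<ge> s m}" using I by (intro card_mono) auto
  then show ?thesis using m(1) by simp
next
  case True
  show ?thesis using t by (simp only: True card.empty of_nat_0)
qed

text \<open>At the true output the augmented data are the whole sample, a multiset that permutations
  do not change; the score function is then symmetric in the observations.\<close>

lemma data_aug_eq_image_mset: "data_aug n z (snd (z (n + 1))) = image_mset z (mset_set {1..n+1})"
  by (simp add: data_aug_def data_def atLeastAtMostSuc_conv)

text \<open>The summand 1 in the region is the index \<open>n+1\<close> compared with
  itself.\<close>

lemma snd_in_full_region_iff:
  fixes z :: "nat \<Rightarrow> (real^'d) \<times> (real^'p)" and \<H> ip loss lam a
  assumes "snd (z (n + 1)) \<in> \<Y>"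
  defines "s \<equiv> score \<H> ip loss lam a (image_mset z (mset_set {1..n+1}))"
  shows "snd (z (n + 1)) \<in> full_region \<Y> \<H> ip loss lam a \<alpha> n z
    \<longleftrightarrow> real (card {i \<in> {1..n+1}. s (z i) \<ge> s (z (n + 1))}) > \<alpha> * (real n + 1)"
proof -
  have "{i \<in> {1..n+1}. s (z i) \<ge> s (z (n + 1))} = insert (n + 1) {i \<in> {1..n}. s (z i) \<ge> s (z (n + 1))}"
    by (auto simp: le_Suc_eq)
  then have "real (card {i \<in> {1..n+1}. s (z i) \<ge> s (z (n + 1))})
      = 1 + (\<Sum>i=1..n. of_bool (s (z i) \<ge> s (z (n + 1))))"
    by (simp add: of_bool_def sum.If_cases Int_def)
  then show ?thesis
    unfolding full_region_def mem_Collect_eq data_aug_eq_image_mset s_def prod.collapse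
    using assms(1) by (simp add: pos_less_divide_eq)
qed

context prob_space
begin

lemma exchangeable_measurable_permuted:
  assumes "exchangeable M N I Z" "\<pi> permutes I"
  shows "(\<lambda>\<omega>. \<lambda>i\<in>I. Z (\<pi> i) \<omega>) \<in> measurable M (Pi\<^sub>M I (\<lambda>_. N))"
  using assms by (intro measurable_restrict) (auto simp: exchangeable_def permutes_in_image)

lemma exchangeable_prob_permuted:
  assumes ex: "exchangeable M N I Z" and p: "\<pi> permutes I" and E: "E \<in> sets (Pi\<^sub>M I (\<lambda>_. N))"
  shows "prob ((\<lambda>\<omega>. \<lambda>i\<in>I. Z (\<pi> i) \<omega>) -` E \<inter> space M) = prob ((\<lambda>\<omega>. \<lambda>i\<in>I. Z i \<omega>) -` E \<inter> space M)"
  using measure_distr[OF exchangeable_measurable_permuted[OF ex p] E]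
    measure_distr[OF exchangeable_measurable_permuted[OF ex permutes_id] E] ex p
  by (simp add: exchangeable_def)

lemma full_region_coverage:
  fixes Z :: "nat \<Rightarrow> 'a \<Rightarrow> (real^'d) \<times> (real^'p)"
  assumes ex: "exchangeable M N {1..n+1} Z" and N: "space N \<subseteq> UNIV \<times> \<Y>" and \<alpha>: "\<alpha> \<ge> 0"
    and meas: "Measurable.pred (Pi\<^sub>M {1..n+1} (\<lambda>_. N))
      (\<lambda>z. snd (z (n+1)) \<in> full_region \<Y> \<H> ip loss lam a \<alpha> n z)"
  shows "\<P>(\<omega> in M. snd (Z (n+1) \<omega>) \<in> full_region \<Y> \<H> ip loss lam a \<alpha> n (\<lambda>i. Z i \<omega>)) \<ge> 1 - \<alpha>"
proof -
  let ?I = "{1..n+1}" and ?C = "\<lambda>z. snd (z (n+1)) \<in> full_region \<Y> \<H> ip loss lam a \<alpha> n z"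
  define E where "E = {z \<in> space (Pi\<^sub>M ?I (\<lambda>_. N)). \<not> ?C z}"
  have E: "E \<in> sets (Pi\<^sub>M ?I (\<lambda>_. N))" unfolding E_def using meas by measurable
  \<comment> \<open>The transposition moves observation \<open>j\<close> to the test position, so
    \<open>A j\<close> is the event that it is missed when it plays that part.\<close>
  define \<pi> where "\<pi> j = Transposition.transpose j (n + 1)" for j :: nat
  have \<pi>: "\<pi> j permutes ?I" if "j \<in> ?I" for j
    unfolding \<pi>_def using that by (intro permutes_swap_id) auto
  define W where "W j = (\<lambda>\<omega>. \<lambda>i\<in>?I. Z (\<pi> j i) \<omega>)" for j
  define A where "A j = W j -` E \<inter> space M" for j
  define B where "B = (\<lambda>\<omega>. \<lambda>i\<in>?I. Z i \<omega>) -` E \<inter> space M"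
  have W: "W j \<in> measurable M (Pi\<^sub>M ?I (\<lambda>_. N))" if "j \<in> ?I" for j
    unfolding W_def by (rule exchangeable_measurable_permuted[OF ex \<pi>[OF that]])
  have Z: "(\<lambda>\<omega>. \<lambda>i\<in>?I. Z i \<omega>) \<in> measurable M (Pi\<^sub>M ?I (\<lambda>_. N))"
    using exchangeable_measurable_permuted[OF ex permutes_id] by (simp only: id_apply)
  have A: "A j \<in> events" if "j \<in> ?I" for j
    unfolding A_def by (rule measurable_sets[OF W[OF that] E])
  have B: "B \<in> events"
    unfolding B_def by (rule measurable_sets[OF Z E])
  have pA: "prob (A j) = prob B" if "j \<in> ?I" for j
    unfolding A_def B_def W_def by (rule exchangeable_prob_permuted[OF ex \<pi>[OF that] E])
  have ZY: "snd (Z i \<omega>) \<in> \<Y>" if "i \<in> ?I" "\<omega> \<in> space M" for i \<omega>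
    using that ex measurable_space[of "Z i" M N \<omega>] N by (auto simp: exchangeable_def)
  have "(\<Sum>j\<in>?I. indicator (A j) \<omega>) \<le> \<alpha> * (real n + 1)" if \<omega>: "\<omega> \<in> space M" for \<omega>
  proof -
    define D where "D = image_mset (\<lambda>i. Z i \<omega>) (mset_set ?I)"
    define s where "s i = score \<H> ip loss lam a D (Z i \<omega>)" for i
    \<comment> \<open>The permuted sample has the same multiset \<open>D\<close>, so all the events
      \<open>A j\<close> are rank conditions on one common family of scores.\<close>
    have iff: "\<omega> \<in> A j \<longleftrightarrow> real (card {i \<in> ?I. s i \<ge> s j}) \<le> \<alpha> * (real n + 1)" if j: "j \<in> ?I" for j
    proof -
      have "image_mset (W j \<omega>) (mset_set ?I) = image_mset (\<lambda>i. Z (\<pi> j i) \<omega>) (mset_set ?I)"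
        by (intro image_mset_cong) (simp add: W_def)
      also have "\<dots> = image_mset (\<lambda>i. Z i \<omega>) (image_mset (\<pi> j) (mset_set ?I))"
        by (simp add: multiset.map_comp o_def)
      also have "image_mset (\<pi> j) (mset_set ?I) = mset_set ?I"
        using \<pi>[OF j] by (simp add: image_mset_mset_set permutes_inj_on permutes_image)
      finally have D: "image_mset (W j \<omega>) (mset_set ?I) = D" by (simp only: D_def)
      have Wn: "W j \<omega> (n + 1) = Z j \<omega>" by (simp add: W_def \<pi>_def)
      have "{i \<in> ?I. s i \<ge> s j} = \<pi> j ` {i \<in> ?I. s (\<pi> j i) \<ge> s j}"
      proof -
        have "bij_betw (\<pi> j) ?I ?I" using \<pi>[OF j] by (rule permutes_imp_bij)
        then have "\<pi> j ` {i \<in> ?I. s (\<pi> j i) \<ge> s j} = {i \<in> \<pi> j ` ?I. s i \<ge> s j}" by blast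
        then show ?thesis using permutes_image[OF \<pi>[OF j]] by simp
      qed
      then have "card {i \<in> ?I. s i \<ge> s j} = card {i \<in> ?I. s (\<pi> j i) \<ge> s j}"
        using permutes_inj_on[OF \<pi>[OF j]] by (simp add: card_image)
      also have "{i \<in> ?I. s (\<pi> j i) \<ge> s j} = {i \<in> ?I. score \<H> ip loss lam a D (W j \<omega> i)
          \<ge> score \<H> ip loss lam a D (W j \<omega> (n + 1))}"
        unfolding Wn by (auto simp: W_def s_def)
      finally have "real (card {i \<in> ?I. s i \<ge> s j}) \<le> \<alpha> * (real n + 1) \<longleftrightarrow> \<not> ?C (W j \<omega>)"
        using snd_in_full_region_iff[of "W j \<omega>" n \<Y> \<H> ip loss lam a \<alpha>] ZY[OF j \<omega>] unfolding D Wn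
        by (simp add: not_less)
      then show ?thesis
        using measurable_space[OF W[OF j] \<omega>] \<omega> by (simp add: A_def E_def)
    qed
    have "(\<Sum>j\<in>?I. indicator (A j) \<omega> :: real) = (\<Sum>j\<in>?I. of_bool (real (card {i \<in> ?I. s i \<ge> s j}) \<le> \<alpha> * (real n + 1)))"
      by (intro sum.cong refl) (simp add: iff indicator_def)
    also have "\<dots> = real (card {j \<in> ?I. real (card {i \<in> ?I. s i \<ge> s j}) \<le> \<alpha> * (real n + 1)})"
      by (simp only: sum_of_bool_eq finite_atLeastAtMost Int_def mem_Collect_eq)
    also have "\<dots> \<le> \<alpha> * (real n + 1)"
      using \<alpha> by (intro card_low_rank_le) auto
    finally show ?thesis .
  qed
  \<comment> \<open>Integrating the pointwise count bounds the sum of \<open>n+1\<close>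
    probabilities, all equal to that of \<open>B\<close>.\<close>
  then have "expectation (\<lambda>\<omega>. \<Sum>j\<in>?I. indicator (A j) \<omega>) \<le> expectation (\<lambda>_. \<alpha> * (real n + 1))"
    using A by (intro integral_mono) (auto simp: less_top[symmetric] intro!: Bochner_Integration.integrable_sum integrable_real_indicator)
  moreover have "expectation (\<lambda>\<omega>. \<Sum>j\<in>?I. indicator (A j) \<omega>) = (\<Sum>j\<in>?I. prob (A j))"
    using A by (subst Bochner_Integration.integral_sum) (auto simp: less_top[symmetric] intro!: integrable_real_indicator sum.cong)
  ultimately have "(real n + 1) * prob B \<le> \<alpha> * (real n + 1)" by (simp add: pA prob_space add_ac)
  then have "prob B \<le> \<alpha>" by (simp add: mult.commute)
  moreover have "{\<omega> \<in> space M. snd (Z (n+1) \<omega>) \<in> full_region \<Y> \<H> ip loss lam a \<alpha> n (\<lambda>i. Z i \<omega>)} = space M - B"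
  proof -
    have "?C (\<lambda>i\<in>?I. Z i \<omega>) \<longleftrightarrow> ?C (\<lambda>i. Z i \<omega>)" for \<omega>
      using full_region_cong[of n "\<lambda>i\<in>?I. Z i \<omega>" "\<lambda>i. Z i \<omega>"] by simp
    then show ?thesis
      using measurable_space[OF Z]
      by (auto simp: B_def E_def)
  qed
  ultimately show ?thesis using prob_compl[OF B] by simp
qed

end

text \<open>The inclusion holds for every outcome. The probability bounds are stated under
  measurability of the two membership predicates, since \<open>measure\<close> assigns 0 by
  convention to a set that is not measurable.\<close>

theorem mainTheorem4:
  fixes M :: "'w measure"
    and \<X> :: "(real^'d::finite) set" and \<Y> :: "(real^'p::finite) set"
    and X :: "nat \<Rightarrow> 'w \<Rightarrow> real^'d" and Y :: "nat \<Rightarrow> 'w \<Rightarrow> real^'p"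
    and \<H> :: "(real^'d \<Rightarrow> real^'p) set"
    and ip :: "(real^'d \<Rightarrow> real^'p) \<Rightarrow> (real^'d \<Rightarrow> real^'p) \<Rightarrow> real"
    and K :: "real^'d \<Rightarrow> real^'d \<Rightarrow> real^'p^'p"
    and loss :: "real^'p \<Rightarrow> real^'p \<Rightarrow> real"
    and n :: nat and lam a \<rho> c \<alpha> :: real
  assumes "prob_space M"
    and "n \<ge> 1"
    and exch: "exchangeable M (restrict_space borel (\<X> \<times> \<Y>)) {1..n+1} (\<lambda>i \<omega>. (X i \<omega>, Y i \<omega>))"
    and "rkhs \<X> \<H> ip K"
    and "lam > 0" and "0 < a" and "a < 1"
    and convex: "\<And>y. y \<in> \<Y> \<Longrightarrow> convex_on UNIV (\<lambda>u. loss y u)"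
    and "\<rho> > 0"
    and lipschitz: "\<And>y. y \<in> \<Y> \<Longrightarrow> \<rho>-lipschitz_on UNIV (\<lambda>u. loss y u)"
    and bounded_below: "\<And>y u. loss y u \<ge> c"
    and "1 / (real n + 1) \<le> \<alpha>" and "\<alpha> < 1"
  shows "(\<forall>\<omega>\<in>space M.
            full_region \<Y> \<H> ip loss lam a \<alpha> n (\<lambda>i. (X i \<omega>, Y i \<omega>))
              \<subseteq> up_region \<Y> \<H> ip K loss \<rho> lam a \<alpha> n (\<lambda>i. (X i \<omega>, Y i \<omega>)))
       \<and> (Measurable.pred (Pi\<^sub>M {1..n+1} (\<lambda>_. restrict_space borel (\<X> \<times> \<Y>)))
             (\<lambda>z. snd (z (n+1)) \<in> full_region \<Y> \<H> ip loss lam a \<alpha> n z) \<longrightarrow>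
          Measurable.pred (Pi\<^sub>M {1..n+1} (\<lambda>_. restrict_space borel (\<X> \<times> \<Y>)))
             (\<lambda>z. snd (z (n+1)) \<in> up_region \<Y> \<H> ip K loss \<rho> lam a \<alpha> n z) \<longrightarrow>
          \<P>(\<omega> in M. Y (n+1) \<omega> \<in> up_region \<Y> \<H> ip K loss \<rho> lam a \<alpha> n (\<lambda>i. (X i \<omega>, Y i \<omega>)))
            \<ge> \<P>(\<omega> in M. Y (n+1) \<omega> \<in> full_region \<Y> \<H> ip loss lam a \<alpha> n (\<lambda>i. (X i \<omega>, Y i \<omega>)))
        \<and> \<P>(\<omega> in M. Y (n+1) \<omega> \<in> full_region \<Y> \<H> ip loss lam a \<alpha> n (\<lambda>i. (X i \<omega>, Y i \<omega>)))
            \<ge> 1 - \<alpha>)"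
proof -
  interpret prob_space M by fact
  interpret rkhs_loss \<X> \<H> ip K \<Y> loss \<rho> c
    by (intro rkhs_loss.intro rkhs_loss_axioms.intro) fact+
  let ?N = "restrict_space borel (\<X> \<times> \<Y>) :: ((real^'d) \<times> (real^'p)) measure"
  let ?Z = "\<lambda>i \<omega>. (X i \<omega>, Y i \<omega>)"
  let ?full = "\<lambda>\<omega>. full_region \<Y> \<H> ip loss lam a \<alpha> n (\<lambda>i. ?Z i \<omega>)"
  let ?up = "\<lambda>\<omega>. up_region \<Y> \<H> ip K loss \<rho> lam a \<alpha> n (\<lambda>i. ?Z i \<omega>)"
  have Z: "?Z i \<omega> \<in> \<X> \<times> \<Y>" if "i \<in> {1..n+1}" "\<omega> \<in> space M" for i \<omega>
    using that exch measurable_space[of "?Z i" M ?N \<omega>] unfolding exchangeable_def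
    by (auto simp: space_restrict_space)
  have sub: "?full \<omega> \<subseteq> ?up \<omega>" if "\<omega> \<in> space M" for \<omega>
    by (rule full_region_subset_up_region) (use Z that assms in auto)
  moreover have "\<P>(\<omega> in M. Y (n+1) \<omega> \<in> ?up \<omega>) \<ge> \<P>(\<omega> in M. Y (n+1) \<omega> \<in> ?full \<omega>)"
    if up: "Measurable.pred (Pi\<^sub>M {1..n+1} (\<lambda>_. ?N)) (\<lambda>z. snd (z (n+1)) \<in> up_region \<Y> \<H> ip K loss \<rho> lam a \<alpha> n z)"
  proof (rule finite_measure_mono)
    have "(\<lambda>\<omega>. \<lambda>i\<in>{1..n+1}. ?Z i \<omega>) \<in> measurable M (Pi\<^sub>M {1..n+1} (\<lambda>_. ?N))"
      using exchangeable_measurable_permuted[OF exch permutes_id] by simp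
    from measurable_compose[OF this up]
    have "Measurable.pred M (\<lambda>\<omega>. Y (n+1) \<omega> \<in> up_region \<Y> \<H> ip K loss \<rho> lam a \<alpha> n (\<lambda>i\<in>{1..n+1}. ?Z i \<omega>))"
      by simp
    \<comment> \<open>Measurability was obtained for the restricted sequence; the region is the same
      for the unrestricted one.\<close>
    moreover have "up_region \<Y> \<H> ip K loss \<rho> lam a \<alpha> n (\<lambda>i\<in>{1..n+1}. ?Z i \<omega>) = ?up \<omega>" for \<omega>
      by (rule up_region_cong) simp
    ultimately show "{\<omega> \<in> space M. Y (n+1) \<omega> \<in> ?up \<omega>} \<in> events" by simp
  qed (use sub in auto)
  moreover have "\<P>(\<omega> in M. Y (n+1) \<omega> \<in> ?full \<omega>) \<ge> 1 - \<alpha>"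
    if "Measurable.pred (Pi\<^sub>M {1..n+1} (\<lambda>_. ?N)) (\<lambda>z. snd (z (n+1)) \<in> full_region \<Y> \<H> ip loss lam a \<alpha> n z)"
  proof -
    have "\<alpha> \<ge> 0" using \<open>1 / (real n + 1) \<le> \<alpha>\<close> by (rule order_trans[rotated]) simp
    then show ?thesis
      using full_region_coverage[OF exch _ _ that] by (simp add: space_restrict_space subset_iff)
  qed
  ultimately show ?thesis by blast
qed

end
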